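(* Let $G$ be a finite group and $\chi\in\mathrm{Irr}_K(G)$ a character of central type. Then the $\mathcal{O}$-algebra $\mathcal{O}Ge(\chi)$ is symmetric.
   Context: Let $p$ be a prime and $\mathcal{O}$ a complete discrete valuation ring with residue field $k$ of characteristic $p$ and quotient field $K$ of characteristic zero; $K$ and $k$ are assumed to be splitting fields for all finite groups under consideration. $\mathrm{Irr}_K(G)$ is the set of irreducible $K$-valued characters of $G$. A character $\chi\in\mathrm{Irr}_K(G)$ is of central type if $\chi(1)^2=|G:Z(G)|$. For $\chi\in\mathrm{Irr}_K(G)$, $e(\chi)=\frac{\chi(1)}{|G|}\sum_{x\in G}\chi(x^{-1})x$ is the primitive idempotent of $Z(KG)$ corresponding to $\chi$, and $\mathcal{O}Ge(\chi)\subseteq KG$ is the image of $\mathcal{O}G$ under multiplication by $e(\chi)$, an $\mathcal{O}$-algebra with unit $e(\chi)$. An $\mathcal{O}$-algebra $A$ is symmetric if $A$ is finitely generated projective as an $\mathcal{O}$-module and $A\cong\mathrm{Hom}_{\mathcal{O}}(A,\mathcal{O})$ as $A$-$A$-bimodules. *)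

theory Defs
  imports
    "HOL-Computational_Algebra.Polynomial_Factorial"
    "HOL-Algebra.Algebra"
    "Jordan_Normal_Form.VS_Connect"
begin

hide_const (open) Polynomial.smult Polynomial.order Modules.module Multiset.mult
  Wellorder_Constructions.zero Divisibility.prime

section \<open>Complete discrete valuation rings\<close>

definition discrete_valuation_ring :: "('a, 'b) ring_scheme \<Rightarrow> bool" where
  "discrete_valuation_ring R \<longleftrightarrow>
     principal_domain R \<and> \<not> field R \<and> (\<exists>!J. maximalideal J R)"

fun ideal_power :: "('a, 'b) ring_scheme \<Rightarrow> 'a set \<Rightarrow> nat \<Rightarrow> 'a set" where
  "ideal_power R J 0 = carrier R"
| "ideal_power R J (Suc n) = ideal_prod R (ideal_power R J n) J"

text \<open>The two conjuncts are injectivity and surjectivity of the canonical map from \<open>R\<close> to the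
  inverse limit of the rings \<open>R / J^n\<close>.\<close>

definition adically_complete :: "('a, 'b) ring_scheme \<Rightarrow> 'a set \<Rightarrow> bool" where
  "adically_complete R J \<longleftrightarrow>
     (\<Inter>n. ideal_power R J n) = {\<zero>\<^bsub>R\<^esub>} \<and>
     (\<forall>a :: nat \<Rightarrow> 'a.
        (\<forall>n. a n \<in> carrier R) \<and> (\<forall>n. a (Suc n) \<ominus>\<^bsub>R\<^esub> a n \<in> ideal_power R J n) \<longrightarrow>
        (\<exists>x\<in>carrier R. \<forall>n. x \<ominus>\<^bsub>R\<^esub> a n \<in> ideal_power R J n))"

definition complete_discrete_valuation_ring :: "('a, 'b) ring_scheme \<Rightarrow> bool" where
  "complete_discrete_valuation_ring R \<longleftrightarrow>
     discrete_valuation_ring R \<and> (\<forall>J. maximalideal J R \<longrightarrow> adically_complete R J)"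

text \<open>\<open>F\<close> is a residue field of the local ring \<open>R\<close>, up to isomorphism.\<close>

definition is_residue_field :: "('a, 'b) ring_scheme \<Rightarrow> ('c, 'd) ring_scheme \<Rightarrow> bool" where
  "is_residue_field R F \<longleftrightarrow> (\<exists>J. maximalideal J R \<and> R Quot J \<simeq> F)"


section \<open>Representations and characters\<close>

definition matrix_representation ::
  "('g, 'x) monoid_scheme \<Rightarrow> nat \<Rightarrow> ('g \<Rightarrow> 'k::field mat) \<Rightarrow> bool" where
  "matrix_representation G n \<rho> \<longleftrightarrow> \<rho> \<in> hom G (units_of (ring_mat TYPE('k) n ()))"

definition irreducible_representation ::
  "('g, 'x) monoid_scheme \<Rightarrow> nat \<Rightarrow> ('g \<Rightarrow> 'k::field mat) \<Rightarrow> bool" where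
  "irreducible_representation G n \<rho> \<longleftrightarrow>
     matrix_representation G n \<rho> \<and> n > 0 \<and>
     (\<forall>W. VectorSpace.subspace class_ring W (module_vec TYPE('k) n) \<and>
          (\<forall>g\<in>carrier G. \<forall>w\<in>W. \<rho> g *\<^sub>v w \<in> W) \<longrightarrow>
          W = {0\<^sub>v n} \<or> W = carrier_vec n)"

definition mat_trace :: "'k::comm_monoid_add mat \<Rightarrow> 'k" where
  "mat_trace A = (\<Sum>i<dim_row A. A $$ (i, i))"

text \<open>Characters are extensional functions on \<open>carrier G\<close>, so that distinct elements of \<open>Irr G\<close>
  are distinct characters. The coefficient field is the type \<open>'k\<close>.\<close>

definition Irr :: "('g, 'x) monoid_scheme \<Rightarrow> ('g \<Rightarrow> 'k::field) set" where
  "Irr G = {\<chi>. \<exists>n \<rho>. irreducible_representation G n \<rho> \<and>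
                     \<chi> = (\<lambda>g\<in>carrier G. mat_trace (\<rho> g))}"

text \<open>The field \<open>'k\<close> is a splitting field for \<open>G\<close> if every simple module over the group algebra
  of \<open>G\<close> over \<open>'k\<close> has only the scalars as endomorphisms.\<close>

definition splitting_field :: "'k::field itself \<Rightarrow> ('g, 'x) monoid_scheme \<Rightarrow> bool" where
  "splitting_field _ G \<longleftrightarrow>
     (\<forall>n (\<rho> :: 'g \<Rightarrow> 'k mat). irreducible_representation G n \<rho> \<longrightarrow>
        (\<forall>T\<in>carrier_mat n n. (\<forall>g\<in>carrier G. T * \<rho> g = \<rho> g * T) \<longrightarrow>
           (\<exists>c. T = c \<cdot>\<^sub>m 1\<^sub>m n)))"

definition group_center :: "('g, 'x) monoid_scheme \<Rightarrow> 'g set" where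
  "group_center G = {z \<in> carrier G. \<forall>x\<in>carrier G. z \<otimes>\<^bsub>G\<^esub> x = x \<otimes>\<^bsub>G\<^esub> z}"

definition central_type :: "('g, 'x) monoid_scheme \<Rightarrow> ('g \<Rightarrow> 'k::field) \<Rightarrow> bool" where
  "central_type G \<chi> \<longleftrightarrow> (\<chi> \<one>\<^bsub>G\<^esub>)\<^sup>2 = of_nat (card (rcosets\<^bsub>G\<^esub> (group_center G)))"


section \<open>Group algebras\<close>

text \<open>For a finite group \<open>G\<close>, the element \<open>\<Sum>x\<in>G. a(x) x\<close> of the group algebra is represented by
  its coefficient function \<open>a\<close>, which is \<open>0\<close> outside \<open>carrier G\<close>.\<close>

definition group_algebra ::
  "('g, 'x) monoid_scheme \<Rightarrow> ('r::comm_ring_1, 'g \<Rightarrow> 'r) module" where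
  "group_algebra G =
     \<lparr>carrier = {a. \<forall>x. x \<notin> carrier G \<longrightarrow> a x = 0},
      mult = (\<lambda>a b x. if x \<in> carrier G
                 then \<Sum>y\<in>carrier G. a y * b (inv\<^bsub>G\<^esub> y \<otimes>\<^bsub>G\<^esub> x) else 0),
      one = (\<lambda>x. if x = \<one>\<^bsub>G\<^esub> then 1 else 0),
      zero = (\<lambda>x. 0),
      add = (\<lambda>a b x. a x + b x),
      smult = (\<lambda>c a x. c * a x)\<rparr>"

definition char_idempotent :: "('g, 'x) monoid_scheme \<Rightarrow> ('g \<Rightarrow> 'k::field) \<Rightarrow> 'g \<Rightarrow> 'k" where
  "char_idempotent G \<chi> =
     (\<lambda>x. if x \<in> carrier G
          then \<chi> \<one>\<^bsub>G\<^esub> / of_nat (order G) * \<chi> (inv\<^bsub>G\<^esub> x) else 0)"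

text \<open>The algebra \<open>\<O>Ge(\<chi>)\<close>, where \<open>\<O>\<close> is the type \<open>'o\<close> and its quotient field \<open>K\<close> is the
  type \<open>'o fract\<close>. The ring \<open>\<O>\<close> is viewed as a subring of \<open>K\<close> via \<^const>\<open>to_fract\<close>.\<close>

definition char_algebra ::
  "('g, 'x) monoid_scheme \<Rightarrow> ('g \<Rightarrow> 'o::idom fract) \<Rightarrow> ('o, 'g \<Rightarrow> 'o fract) module" where
  "char_algebra G \<chi> =
     (let KG = group_algebra G :: ('o fract, 'g \<Rightarrow> 'o fract) module;
          OG = group_algebra G :: ('o, 'g \<Rightarrow> 'o) module;
          e = char_idempotent G \<chi>
      in \<lparr>carrier = {(to_fract \<circ> a) \<otimes>\<^bsub>KG\<^esub> e | a. a \<in> carrier OG},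
          mult = mult KG,
          one = e,
          zero = zero KG,
          add = add KG,
          smult = (\<lambda>c a. to_fract c \<odot>\<^bsub>KG\<^esub> a)\<rparr>)"


section \<open>Symmetric algebras\<close>

text \<open>Unlike the locale \<^locale>\<open>algebra\<close>, this does not require \<open>A\<close> to be commutative.\<close>

definition associative_algebra ::
  "('r, 'x) ring_scheme \<Rightarrow> ('r, 'a, 'y) module_scheme \<Rightarrow> bool" where
  "associative_algebra R A \<longleftrightarrow>
     module R A \<and> ring A \<and>
     (\<forall>c\<in>carrier R. \<forall>a\<in>carrier A. \<forall>b\<in>carrier A.
        (c \<odot>\<^bsub>A\<^esub> a) \<otimes>\<^bsub>A\<^esub> b = c \<odot>\<^bsub>A\<^esub> (a \<otimes>\<^bsub>A\<^esub> b) \<and>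
        a \<otimes>\<^bsub>A\<^esub> (c \<odot>\<^bsub>A\<^esub> b) = c \<odot>\<^bsub>A\<^esub> (a \<otimes>\<^bsub>A\<^esub> b))"

definition finitely_generated_module ::
  "('r, 'x) ring_scheme \<Rightarrow> ('r, 'm, 'y) module_scheme \<Rightarrow> bool" where
  "finitely_generated_module R M \<longleftrightarrow>
     (\<exists>S. finite S \<and> S \<subseteq> carrier M \<and> LinearCombinations.module.span R M S = carrier M)"

text \<open>The free \<open>R\<close>-module with basis indexed by \<open>I\<close>, as finitely supported functions; its ring
  multiplication plays no role.\<close>

definition free_module :: "('r, 'x) ring_scheme \<Rightarrow> 'i set \<Rightarrow> ('r, 'i \<Rightarrow> 'r) module" where
  "free_module R I =
     \<lparr>carrier = {f. (\<forall>i\<in>I. f i \<in> carrier R) \<and> (\<forall>i. i \<notin> I \<longrightarrow> f i = \<zero>\<^bsub>R\<^esub>) \<and>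
                    finite {i. f i \<noteq> \<zero>\<^bsub>R\<^esub>}},
      mult = undefined,
      one = undefined,
      zero = (\<lambda>i. \<zero>\<^bsub>R\<^esub>),
      add = (\<lambda>f g i. f i \<oplus>\<^bsub>R\<^esub> g i),
      smult = (\<lambda>c f i. c \<otimes>\<^bsub>R\<^esub> f i)\<rparr>"

text \<open>Projective: (isomorphic to) a direct summand of a free module. Index sets of basis elements
  may be taken inside the type of \<open>M\<close>, since a projective module \<open>M\<close> is a direct
  summand of the free module with basis \<open>carrier M\<close>.\<close>

definition projective_module ::
  "('r, 'x) ring_scheme \<Rightarrow> ('r, 'm, 'y) module_scheme \<Rightarrow> bool" where
  "projective_module R M \<longleftrightarrow>
     (\<exists>(I :: 'm set) \<iota> \<pi>.
        \<iota> \<in> module_hom R M (free_module R I) \<and>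
        \<pi> \<in> module_hom R (free_module R I) M \<and>
        (\<forall>x\<in>carrier M. \<pi> (\<iota> x) = x))"

definition regular_module :: "('r, 'x) ring_scheme \<Rightarrow> ('r, 'r) module" where
  "regular_module R =
     \<lparr>carrier = carrier R, mult = mult R, one = one R, zero = zero R, add = add R,
      smult = mult R\<rparr>"

text \<open>\<open>Hom\<^sub>R(M, R)\<close>. Its elements are extensional so that equality of functionals is equality
  on \<open>carrier M\<close>; the ring multiplication plays no role.\<close>

definition dual_module ::
  "('r, 'x) ring_scheme \<Rightarrow> ('r, 'm, 'y) module_scheme \<Rightarrow> ('r, 'm \<Rightarrow> 'r) module" where
  "dual_module R M =
     \<lparr>carrier = module_hom R M (regular_module R) \<inter> extensional (carrier M),
      mult = undefined,
      one = undefined,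
      zero = (\<lambda>x\<in>carrier M. \<zero>\<^bsub>R\<^esub>),
      add = (\<lambda>f g. \<lambda>x\<in>carrier M. f x \<oplus>\<^bsub>R\<^esub> g x),
      smult = (\<lambda>c f. \<lambda>x\<in>carrier M. c \<otimes>\<^bsub>R\<^esub> f x)\<rparr>"

text \<open>The \<open>A\<close>-\<open>A\<close>-bimodule structure on \<open>Hom\<^sub>R(A, R)\<close>: \<open>(a \<cdot> f)(x) = f(xa)\<close> and
  \<open>(f \<cdot> b)(x) = f(bx)\<close>.\<close>

definition dual_left_action ::
  "('r, 'a, 'y) module_scheme \<Rightarrow> 'a \<Rightarrow> ('a \<Rightarrow> 'r) \<Rightarrow> 'a \<Rightarrow> 'r" where
  "dual_left_action A a f = (\<lambda>x\<in>carrier A. f (x \<otimes>\<^bsub>A\<^esub> a))"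

definition dual_right_action ::
  "('r, 'a, 'y) module_scheme \<Rightarrow> ('a \<Rightarrow> 'r) \<Rightarrow> 'a \<Rightarrow> 'a \<Rightarrow> 'r" where
  "dual_right_action A f b = (\<lambda>x\<in>carrier A. f (b \<otimes>\<^bsub>A\<^esub> x))"

definition symmetric_algebra ::
  "('r, 'x) ring_scheme \<Rightarrow> ('r, 'a, 'y) module_scheme \<Rightarrow> bool" where
  "symmetric_algebra R A \<longleftrightarrow>
     associative_algebra R A \<and>
     finitely_generated_module R A \<and> projective_module R A \<and>
     (\<exists>\<Phi>. \<Phi> \<in> module_hom R A (dual_module R A) \<and>
          bij_betw \<Phi> (carrier A) (carrier (dual_module R A)) \<and>
          (\<forall>a\<in>carrier A. \<forall>x\<in>carrier A.
             \<Phi> (a \<otimes>\<^bsub>A\<^esub> x) = dual_left_action A a (\<Phi> x) \<and>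
             \<Phi> (x \<otimes>\<^bsub>A\<^esub> a) = dual_right_action A (\<Phi> x) a))"

end

theory Submission
  imports Defs
begin

text \<open>
  Let \<open>\<rho>\<close> be a representation of degree \<open>n\<close> affording \<open>\<chi>\<close>, let \<open>Z\<close> be the center of \<open>G\<close>, and let
  \<open>\<lambda>\<close> be the central character, so that \<open>\<rho>(z) = \<lambda>(z) 1\<close> for \<open>z \<in> Z\<close>. The reason behind the theorem is
  that \<open>\<O>Ge(\<chi>)\<close> is a twisted group algebra of \<open>G/Z\<close> over \<open>\<O>\<close>; such an algebra is symmetric, by
  taking the coefficient of the identity as symmetrizing form.

  Why the algebra has this shape. Schur orthogonality writes every elementary matrix as a linear
  combination of the matrices \<open>\<rho>(t)\<close>, where \<open>t\<close> runs over representatives of the cosets of \<open>Z\<close>.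
  Since \<open>\<chi>\<close> is of central type there are exactly \<open>n\<^sup>2\<close> of these matrices, so the square coefficient
  matrix that expresses this has a two-sided inverse. Reading the inverse relation on the other side
  says that \<open>\<chi>(s\<^sup>-\<^sup>1 t) = 0\<close> for distinct representatives \<open>s\<close> and \<open>t\<close>; that is, \<open>\<chi>\<close> vanishes outside
  \<open>Z\<close> (\<open>central_type_trace_eq_0\<close>). Consequently \<open>e(\<chi>)\<close> is
  \<open>|Z|\<^sup>-\<^sup>1 \<Sum>\<^sub>z \<lambda>(z\<^sup>-\<^sup>1) z\<close>, the idempotent of \<open>\<lambda>\<close> in the group algebra of \<open>Z\<close>
  (\<open>central_type_char_idempotent\<close>). The values of \<open>\<lambda>\<close> are roots of unity, hence lie in the integrally
  closed ring \<open>\<O>\<close> (\<open>root_of_unity_integral\<close>).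

  With this formula, \<open>\<O>Ge(\<chi>)\<close> consists of the functions \<open>f\<close> on \<open>G\<close> with \<open>f(xz) = \<lambda>(z\<^sup>-\<^sup>1) f(x)\<close> and
  \<open>|Z| f(x) \<in> \<O>\<close> (\<open>carrier_char_algebra\<close>). Such an \<open>f\<close> is determined by the values \<open>|Z| f(t)\<close> at the
  coset representatives \<open>t\<close>, which are the coefficients of a preimage of \<open>f\<close> in \<open>\<O>G\<close>. So the projection
  of the free module \<open>\<O>G\<close> of finite rank onto \<open>\<O>Ge(\<chi>)\<close> splits, which gives projectivity.
  The symmetric bilinear form is \<open>(f, g) \<mapsto> |Z| (fg)(1)\<close>. Since \<open>(f, u e(\<chi>)) = |Z| f(u\<^sup>-\<^sup>1)\<close> for \<open>u \<in> G\<close>,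
  the form is nondegenerate, and a functional \<open>\<phi>\<close> is represented by the function
  \<open>x \<mapsto> \<phi>(x\<^sup>-\<^sup>1 e(\<chi>)) / |Z|\<close>, which again lies in \<open>\<O>Ge(\<chi>)\<close> (\<open>pairing_representing_element\<close>).
\<close>

section \<open>Square systems over a field\<close>

text \<open>Indexing by arbitrary finite sets avoids numbering matrix positions and coset representatives
  by hand when the rows are indexed by one and the columns by the other.\<close>

lemma finite_left_inverse_imp_right_inverse:
  fixes U :: "'a \<Rightarrow> 'b \<Rightarrow> 'k::field"
  assumes "finite A" "finite B" "card A = card B"
    and UV: "\<And>i j. i \<in> A \<Longrightarrow> j \<in> A \<Longrightarrow> (\<Sum>b\<in>B. U i b * V b j) = (if i = j then 1 else 0)"
    and "b \<in> B" "c \<in> B"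
  shows "(\<Sum>a\<in>A. V b a * U a c) = (if b = c then 1 else 0)"
proof -
  define n where "n = card A"
  obtain f where f: "bij_betw f {0..<n} A"
    using ex_bij_betw_nat_finite[OF \<open>finite A\<close>] n_def by blast
  obtain h where h: "bij_betw h {0..<n} B"
    using ex_bij_betw_nat_finite[OF \<open>finite B\<close>] n_def assms(3) by metis
  define M where "M = mat n n (\<lambda>(i, j). U (f i) (h j))"
  define N where "N = mat n n (\<lambda>(i, j). V (h i) (f j))"
  have M: "M \<in> carrier_mat n n" and N: "N \<in> carrier_mat n n"
    unfolding M_def N_def by simp_all
  have "M * N = 1\<^sub>m n"
  proof (rule eq_matI)
    fix i j assume ij: "i < dim_row (1\<^sub>m n :: 'k mat)" "j < dim_col (1\<^sub>m n :: 'k mat)"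
    have "(M * N) $$ (i, j) = (\<Sum>m\<in>{0..<n}. U (f i) (h m) * V (h m) (f j))"
      using ij by (simp add: M_def N_def scalar_prod_def)
    also have "\<dots> = (\<Sum>b\<in>B. U (f i) b * V b (f j))"
      by (rule sum.reindex_bij_betw[OF h])
    also have "\<dots> = (if f i = f j then 1 else 0)"
      using ij f by (intro UV) (auto simp: bij_betw_def)
    also have "\<dots> = 1\<^sub>m n $$ (i, j)"
      using ij f by (auto simp: bij_betw_def inj_on_def)
    finally show "(M * N) $$ (i, j) = 1\<^sub>m n $$ (i, j)" .
  qed (simp_all add: M_def N_def)
  then have NM: "N * M = 1\<^sub>m n"
    by (rule mat_mult_left_right_inverse[OF M N])
  have "b \<in> h ` {0..<n}" "c \<in> h ` {0..<n}"
    using h \<open>b \<in> B\<close> \<open>c \<in> B\<close> by (simp_all add: bij_betw_def)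
  then obtain i j where i: "i < n" "h i = b" and j: "j < n" "h j = c"
    by auto
  have "(\<Sum>a\<in>A. V b a * U a c) = (\<Sum>m\<in>{0..<n}. V b (f m) * U (f m) c)"
    by (rule sum.reindex_bij_betw[OF f, symmetric])
  also have "\<dots> = (N * M) $$ (i, j)"
    using i j by (auto simp: M_def N_def scalar_prod_def)
  also have "\<dots> = (if b = c then 1 else 0)"
    using i j h by (auto simp: NM bij_betw_def inj_on_def)
  finally show ?thesis .
qed

section \<open>Roots of unity in the quotient field of a principal ideal domain\<close>

lemma class_ring_a_inv: "a_inv (class_ring :: 'a::ring_1 ring) = uminus"
  by (simp only: class_ring_simps)

lemma principal_domain_bezout:
  fixes a b :: "'o::idom"
  assumes "principal_domain (class_ring :: 'o ring)"
  obtains d a' b' x y where "a = d * a'" "b = d * b'" "d = x * a + y * b"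
proof -
  interpret R: principal_domain "class_ring :: 'o ring" by fact
  define J where "J = {x * a + y * b |x y. True}"
  have "ideal J (class_ring :: 'o ring)"
  proof (rule idealI)
    show "ring (class_ring :: 'o ring)" by (rule class_ring.ring_axioms)
    show "subgroup J (add_monoid (class_ring :: 'o ring))"
    proof (rule group.subgroupI)
      show "group (add_monoid (class_ring :: 'o ring))"
        by (rule R.add.group_axioms)
      show "J \<noteq> {}" unfolding J_def by blast
      show "inv\<^bsub>add_monoid (class_ring :: 'o ring)\<^esub> u \<in> J" if u: "u \<in> J" for u
      proof -
        obtain x y where "u = x * a + y * b" using u unfolding J_def by blast
        then have "- u = (- x) * a + (- y) * b" by (simp add: algebra_simps)
        moreover have "inv\<^bsub>add_monoid (class_ring :: 'o ring)\<^esub> u = - u"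
          using fun_cong[OF class_ring_a_inv, of u] unfolding a_inv_def by simp
        ultimately show ?thesis unfolding J_def by (metis (mono_tags, lifting) mem_Collect_eq)
      qed
      show "u \<otimes>\<^bsub>add_monoid class_ring\<^esub> v \<in> J" if uv: "u \<in> J" "v \<in> J" for u v
      proof -
        obtain x y x' y' where "u = x * a + y * b" "v = x' * a + y' * b"
          using uv unfolding J_def by blast
        then have "u + v = (x + x') * a + (y + y') * b" by (simp add: algebra_simps)
        then show ?thesis unfolding J_def by auto
      qed
    qed simp
    have *: "c * u \<in> J" if u: "u \<in> J" for u c
    proof -
      obtain x y where "u = x * a + y * b" using u unfolding J_def by blast
      then have "c * u = (c * x) * a + (c * y) * b" by (simp add: algebra_simps)
      then show ?thesis unfolding J_def by auto
    qed
    show "c \<otimes>\<^bsub>class_ring\<^esub> u \<in> J" "u \<otimes>\<^bsub>class_ring\<^esub> c \<in> J" if u: "u \<in> J" for u c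
      using *[OF u, of c] by (simp_all add: mult.commute)
  qed
  then obtain d where J: "J = PIdl\<^bsub>(class_ring :: 'o ring)\<^esub> d"
    using R.exists_gen by auto
  have "a = 1 * a + 0 * b" "b = 0 * a + 1 * b" by simp_all
  then have "a \<in> J" "b \<in> J" unfolding J_def by blast+
  then obtain a' b' where "a = a' * d" "b = b' * d"
    unfolding J cgenideal_def by auto
  moreover have "d \<in> J" unfolding J cgenideal_def by (auto intro!: exI[of _ 1])
  then obtain x y where "d = x * a + y * b" unfolding J_def by auto
  ultimately show ?thesis using that by (metis mult.commute)
qed

text \<open>A principal ideal domain is integrally closed; for \<open>c\<^sup>m = 1\<close> the argument is short. Write
  \<open>c = a' / b'\<close> in lowest terms. Then \<open>b'\<close> is coprime to \<open>a'\<close>, hence to \<open>a'\<^sup>m = b'\<^sup>m\<close>, so it is a unit.\<close>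

lemma root_of_unity_integral:
  fixes c :: "'o::idom fract"
  assumes "principal_domain (class_ring :: 'o ring)" and "c ^ m = 1" and "m > 0"
  shows "c \<in> range to_fract"
proof -
  obtain a b where c: "c = Fract a b" "b \<noteq> 0"
    by (cases c) auto
  obtain d a' b' x y where d: "a = d * a'" "b = d * b'" "d = x * a + y * b"
    using principal_domain_bezout[OF assms(1)] by metis
  have "d \<noteq> 0" using d(2) c(2) by auto
  have "d * (x * a' + y * b') = x * a + y * b" by (simp add: d(1,2) algebra_simps)
  then have "d * (x * a' + y * b') = d * 1" using d(3) by simp
  then have xy: "x * a' + y * b' = 1" using \<open>d \<noteq> 0\<close> by simp
  have "b' \<noteq> 0" using c(2) d(2) by auto
  have c': "c = to_fract a' / to_fract b'"
    using c(1) d(1,2) \<open>d \<noteq> 0\<close> by (simp add: Fract_conv_to_fract)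
  have hom: "to_fract (u ^ k) = to_fract u ^ k" for u :: 'o and k
    by (induction k) auto
  have "to_fract (a' ^ m) = to_fract (b' ^ m)"
    using \<open>c ^ m = 1\<close> \<open>b' \<noteq> 0\<close> unfolding c' hom by (simp add: power_divide)
  then have ab: "a' ^ m = b' ^ m" by simp
  have "\<exists>u v. u * a' ^ k + v * b' = 1" for k
  proof (induction k)
    case 0
    show ?case by (intro exI[of _ 1] exI[of _ 0]) simp
  next
    case (Suc k)
    then obtain u v where uv: "u * a' ^ k + v * b' = 1" by blast
    have "1 = (u * a' ^ k + v * b') * (x * a' + y * b')" by (simp add: uv xy)
    also have "\<dots> = (u * x) * a' ^ Suc k + (u * a' ^ k * y + v * x * a' + v * y * b') * b'"
      by (simp add: algebra_simps)
    finally show ?case by metis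
  qed
  then obtain u v where "u * b' ^ m + v * b' = 1" using ab by metis
  then have "b' * (u * b' ^ (m - 1) + v) = 1"
    using \<open>m > 0\<close> by (cases m) (auto simp: algebra_simps)
  then obtain w where "b' * w = 1" by blast
  then have "to_fract b' * to_fract w = 1" by (metis to_fract_1 to_fract_mult)
  then have "c = to_fract (a' * w)"
    using \<open>b' \<noteq> 0\<close> unfolding c' by (simp add: field_simps)
  then show ?thesis by blast
qed

section \<open>Cosets of the center of a finite group\<close>

locale finite_group = group G for G (structure) +
  assumes finite_carrier: "finite (carrier G)"
begin

abbreviation "Z \<equiv> group_center G"

lemma center_closed: "z \<in> Z \<Longrightarrow> z \<in> carrier G"
  by (simp add: group_center_def)

lemma center_commute: "z \<in> Z \<Longrightarrow> x \<in> carrier G \<Longrightarrow> z \<otimes> x = x \<otimes> z"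
  by (simp add: group_center_def)

lemma center_mult:
  assumes "z \<in> Z" "w \<in> Z"
  shows "z \<otimes> w \<in> Z"
proof -
  have "z \<otimes> w \<otimes> x = x \<otimes> (z \<otimes> w)" if x: "x \<in> carrier G" for x
  proof -
    have "z \<otimes> w \<otimes> x = z \<otimes> (x \<otimes> w)"
      using assms x center_closed center_commute[of w x] by (simp add: m_assoc)
    also have "\<dots> = x \<otimes> (z \<otimes> w)"
      using assms x center_closed center_commute[of z x] by (simp flip: m_assoc)
    finally show ?thesis .
  qed
  moreover have "z \<otimes> w \<in> carrier G"
    using assms by (intro m_closed center_closed)
  ultimately show ?thesis unfolding group_center_def by blast
qed

lemma center_one: "\<one> \<in> Z"
  by (simp add: group_center_def)

lemma center_inv:
  assumes "z \<in> Z"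
  shows "inv z \<in> Z"
proof -
  note z = center_closed[OF assms]
  have "inv z \<otimes> x = x \<otimes> inv z" if x: "x \<in> carrier G" for x
  proof -
    have "inv z \<otimes> (z \<otimes> x) = x"
      using x z by (simp flip: m_assoc)
    then have "inv z \<otimes> (x \<otimes> z) = x"
      by (simp only: center_commute[OF assms x])
    then have "inv z \<otimes> x \<otimes> z = x"
      using x z by (simp add: m_assoc)
    then show ?thesis
      using x z by (simp add: inv_solve_right)
  qed
  then show ?thesis
    using z unfolding group_center_def by blast
qed

lemma center_subgroup: "subgroup Z G"
  using center_one by (intro subgroupI) (auto simp: center_closed center_mult center_inv)

lemma finite_center: "finite Z"
  using finite_subset[OF _ finite_carrier] center_closed by blast

lemma card_center_pos: "card Z > 0"
  using finite_center center_one by (auto simp: card_gt_0_iff)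

text \<open>The predicate depends on \<open>x\<close> only through its coset \<open>xZ\<close>, so the choice is constant on cosets
  and the range of this function on \<open>G\<close> is a transversal of \<open>Z\<close>.\<close>

definition coset_rep :: "'a \<Rightarrow> 'a" where
  "coset_rep x = (SOME y. \<exists>z\<in>Z. y = x \<otimes> z)"

lemma coset_repE:
  obtains z where "z \<in> Z" "coset_rep x = x \<otimes> z"
proof -
  have "\<exists>z\<in>Z. coset_rep x = x \<otimes> z"
    unfolding coset_rep_def by (rule someI_ex) (use center_one in blast)
  then show ?thesis using that by blast
qed

lemma coset_rep_closed: "x \<in> carrier G \<Longrightarrow> coset_rep x \<in> carrier G"
  using coset_repE[of x] center_closed m_closed by metis

lemma coset_rep_mult_center:
  assumes "x \<in> carrier G" "z \<in> Z"
  shows "coset_rep (x \<otimes> z) = coset_rep x"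
proof -
  have "(\<exists>w\<in>Z. y = x \<otimes> z \<otimes> w) \<longleftrightarrow> (\<exists>w\<in>Z. y = x \<otimes> w)" for y
  proof
    assume "\<exists>w\<in>Z. y = x \<otimes> z \<otimes> w"
    then show "\<exists>w\<in>Z. y = x \<otimes> w"
      using assms by (metis center_closed center_mult m_assoc)
  next
    assume "\<exists>w\<in>Z. y = x \<otimes> w"
    then obtain w where w: "w \<in> Z" "y = x \<otimes> w" by blast
    moreover have "z \<otimes> (inv z \<otimes> w) = w"
      using assms w center_closed by (simp add: m_assoc[symmetric])
    ultimately have "y = x \<otimes> z \<otimes> (inv z \<otimes> w)"
      using assms center_closed by (simp add: m_assoc)
    then show "\<exists>w\<in>Z. y = x \<otimes> z \<otimes> w"
      using w assms center_mult center_inv by blast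
  qed
  then show ?thesis unfolding coset_rep_def by simp
qed

lemma coset_rep_idem: "x \<in> carrier G \<Longrightarrow> coset_rep (coset_rep x) = coset_rep x"
  using coset_repE[of x] coset_rep_mult_center by metis

lemma coset_rep_fibre:
  assumes "t \<in> coset_rep ` carrier G"
  shows "bij_betw (\<lambda>z. t \<otimes> z) Z {x \<in> carrier G. coset_rep x = t}"
proof -
  have t: "t \<in> carrier G" "coset_rep t = t"
    using assms coset_rep_closed coset_rep_idem by auto
  show ?thesis
  proof (rule bij_betw_imageI)
    show "inj_on ((\<otimes>) t) Z"
      using t center_closed by (auto intro!: inj_onI)
    show "(\<otimes>) t ` Z = {x \<in> carrier G. coset_rep x = t}"
    proof (intro equalityI subsetI)
      fix x assume "x \<in> {x \<in> carrier G. coset_rep x = t}"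
      then have x: "x \<in> carrier G" "coset_rep x = t" by auto
      then obtain z where z: "z \<in> Z" "t = x \<otimes> z" using coset_repE[of x] by metis
      then have "x = t \<otimes> inv z"
        using x center_closed by (simp add: m_assoc)
      then show "x \<in> (\<otimes>) t ` Z" using z center_inv by blast
    qed (use t center_closed coset_rep_mult_center in auto)
  qed
qed

lemma sum_over_cosets:
  fixes h :: "'a \<Rightarrow> 'c::comm_semiring_1"
  assumes "\<And>x z. x \<in> carrier G \<Longrightarrow> z \<in> Z \<Longrightarrow> h (x \<otimes> z) = h x"
  shows "(\<Sum>x\<in>carrier G. h x) = of_nat (card Z) * (\<Sum>t\<in>coset_rep ` carrier G. h t)"
proof -
  have "(\<Sum>x\<in>carrier G. h x) = (\<Sum>t\<in>coset_rep ` carrier G. \<Sum>x\<in>{x \<in> carrier G. coset_rep x = t}. h x)"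
    by (rule sum.image_gen[OF finite_carrier])
  also have "\<dots> = (\<Sum>t\<in>coset_rep ` carrier G. of_nat (card Z) * h t)"
  proof (rule sum.cong[OF refl])
    fix t assume t: "t \<in> coset_rep ` carrier G"
    have "(\<Sum>x\<in>{x \<in> carrier G. coset_rep x = t}. h x) = (\<Sum>z\<in>Z. h (t \<otimes> z))"
      by (rule sum.reindex_bij_betw[OF coset_rep_fibre[OF t], symmetric])
    also have "\<dots> = (\<Sum>z\<in>Z. h t)"
      using t assms coset_rep_closed by (intro sum.cong) auto
    finally show "(\<Sum>x\<in>{x \<in> carrier G. coset_rep x = t}. h x) = of_nat (card Z) * h t" by simp
  qed
  finally show ?thesis by (simp add: sum_distrib_left)
qed

lemma card_coset_reps: "card (coset_rep ` carrier G) = card (rcosets Z)"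
proof -
  have "card (carrier G) = card Z * card (coset_rep ` carrier G)"
    using sum_over_cosets[of "\<lambda>_. 1::nat"] by simp
  moreover have "card (rcosets Z) * card Z = card (carrier G)"
    using lagrange[OF center_subgroup] by (simp add: Coset.order_def)
  ultimately show ?thesis using card_center_pos by (simp add: mult.commute)
qed

lemma sum_left_translate:
  assumes "h \<in> carrier G"
  shows "(\<Sum>g\<in>carrier G. f (h \<otimes> g)) = (\<Sum>g\<in>carrier G. f g)"
proof -
  have "bij_betw (\<lambda>g. h \<otimes> g) (carrier G) (carrier G)"
    by (rule bij_betw_byWitness[where f' = "\<lambda>g. inv h \<otimes> g"])
      (use assms in \<open>auto simp: m_assoc[symmetric]\<close>)
  then show ?thesis by (rule sum.reindex_bij_betw)
qed

lemma sum_inverse: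
  "(\<Sum>g\<in>carrier G. f (inv g)) = (\<Sum>g\<in>carrier G. f g)"
proof -
  have "bij_betw (\<lambda>g. inv g) (carrier G) (carrier G)"
    by (rule bij_betw_byWitness[where f' = "\<lambda>g. inv g"]) auto
  then show ?thesis by (rule sum.reindex_bij_betw)
qed

end

section \<open>Characters of central type vanish outside the center\<close>

text \<open>The last assumption is the conclusion of Schur's lemma for an irreducible representation over a
  splitting field.\<close>

locale splitting_representation = finite_group G for G (structure) +
  fixes n :: nat and \<rho> :: "'a \<Rightarrow> 'k::field mat"
  assumes rep: "matrix_representation G n \<rho>"
    and n_pos: "n > 0"
    and char_0: "CHAR('k) = 0"
    and schur: "\<And>T. T \<in> carrier_mat n n \<Longrightarrow> (\<And>g. g \<in> carrier G \<Longrightarrow> T * \<rho> g = \<rho> g * T)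
      \<Longrightarrow> \<exists>c. T = c \<cdot>\<^sub>m 1\<^sub>m n"
begin

lemma of_nat_eq_0_iff_char_0: "(of_nat m :: 'k) = 0 \<longleftrightarrow> m = 0"
  by (simp add: of_nat_eq_0_iff_char_dvd char_0)

lemma of_nat_eq_iff_char_0: "(of_nat a :: 'k) = of_nat b \<longleftrightarrow> a = b"
proof -
  have "a = b" if "of_nat a = (of_nat b :: 'k)" "a \<le> b" for a b
    using that of_nat_eq_0_iff_char_0[of "b - a"] by (simp add: of_nat_diff)
  then show ?thesis by (metis nat_le_linear)
qed

lemma rep_carrier: "g \<in> carrier G \<Longrightarrow> \<rho> g \<in> carrier_mat n n"
  using rep by (auto simp: matrix_representation_def hom_def units_of_def Units_def ring_mat_simps)

lemma rep_dim: "g \<in> carrier G \<Longrightarrow> dim_row (\<rho> g) = n" "g \<in> carrier G \<Longrightarrow> dim_col (\<rho> g) = n"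
  using rep_carrier by auto

lemma rep_mult: "g \<in> carrier G \<Longrightarrow> h \<in> carrier G \<Longrightarrow> \<rho> (g \<otimes> h) = \<rho> g * \<rho> h"
  using rep by (auto simp: matrix_representation_def hom_def units_of_def ring_mat_simps)

lemma rep_one: "\<rho> \<one> = 1\<^sub>m n"
proof -
  interpret M: ring "ring_mat TYPE('k) n ()" by (rule ring_mat)
  interpret group_hom G "units_of (ring_mat TYPE('k) n ())" \<rho>
    using rep by (intro group_hom.intro group_hom_axioms.intro is_group M.units_group)
      (auto simp: matrix_representation_def)
  show ?thesis using hom_one by (simp add: units_of_def ring_mat_simps)
qed

lemma rep_mult_entry:
  assumes "g \<in> carrier G" "h \<in> carrier G" "i < n" "j < n"
  shows "\<rho> (g \<otimes> h) $$ (i, j) = (\<Sum>m<n. \<rho> g $$ (i, m) * \<rho> h $$ (m, j))"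
  using assms rep_carrier[of g] rep_carrier[of h]
  by (simp add: rep_mult scalar_prod_def atLeast0LessThan)

text \<open>For fixed \<open>j\<close> and \<open>k\<close>, the sums over \<open>G\<close> are the entries of the average
  \<open>\<Sum>\<^sub>g \<rho>(g) E\<^sub>j\<^sub>k \<rho>(g\<^sup>-\<^sup>1)\<close> of an elementary matrix. It commutes with every \<open>\<rho>(h)\<close>, so it is a scalar,
  and the scalar is found by taking traces.\<close>

lemma schur_orthogonality:
  assumes ijkl: "i < n" "j < n" "k < n" "l < n"
  shows "of_nat n * (\<Sum>g\<in>carrier G. \<rho> g $$ (i, j) * \<rho> (inv g) $$ (k, l)) =
    (if i = l \<and> j = k then of_nat (order G) else 0)"
proof -
  let ?s = "\<lambda>i l. \<Sum>g\<in>carrier G. \<rho> g $$ (i, j) * \<rho> (inv g) $$ (k, l)"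
  define S where "S = mat n n (\<lambda>(i, l). ?s i l)"
  have S: "S \<in> carrier_mat n n" by (simp add: S_def)
  have "S * \<rho> h = \<rho> h * S" if h: "h \<in> carrier G" for h
  proof (rule eq_matI)
    fix a b assume "a < dim_row (\<rho> h * S)" "b < dim_col (\<rho> h * S)"
    then have ab: "a < n" "b < n" using h by (simp_all add: rep_dim S_def)
    have "(S * \<rho> h) $$ (a, b) = (\<Sum>m<n. ?s a m * \<rho> h $$ (m, b))"
      using ab h S rep_carrier[OF h] by (simp add: S_def scalar_prod_def atLeast0LessThan)
    also have "\<dots> = (\<Sum>g\<in>carrier G. \<rho> g $$ (a, j) * (\<Sum>m<n. \<rho> (inv g) $$ (k, m) * \<rho> h $$ (m, b)))"
      unfolding sum_distrib_left sum_distrib_right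
      by (subst sum.swap) (simp add: mult.assoc)
    also have "\<dots> = (\<Sum>g\<in>carrier G. \<rho> g $$ (a, j) * \<rho> (inv g \<otimes> h) $$ (k, b))"
      using ab h ijkl by (intro sum.cong) (auto simp: rep_mult_entry)
    also have "\<dots> = (\<Sum>g\<in>carrier G. \<rho> (h \<otimes> g) $$ (a, j) * \<rho> (inv (h \<otimes> g) \<otimes> h) $$ (k, b))"
      by (rule sum_left_translate[OF h, symmetric])
    also have "\<dots> = (\<Sum>g\<in>carrier G. (\<Sum>m<n. \<rho> h $$ (a, m) * \<rho> g $$ (m, j)) * \<rho> (inv g) $$ (k, b))"
      using ab h ijkl by (intro sum.cong) (auto simp: rep_mult_entry inv_mult_group m_assoc)
    also have "\<dots> = (\<Sum>m<n. \<rho> h $$ (a, m) * ?s m b)"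
      unfolding sum_distrib_left sum_distrib_right
      by (subst sum.swap) (simp add: mult.assoc)
    also have "\<dots> = (\<rho> h * S) $$ (a, b)"
      using ab h S rep_carrier[OF h] by (simp add: S_def scalar_prod_def atLeast0LessThan)
    finally show "(S * \<rho> h) $$ (a, b) = (\<rho> h * S) $$ (a, b)" .
  qed (use h in \<open>simp_all add: rep_dim S_def\<close>)
  then obtain c where c: "S = c \<cdot>\<^sub>m 1\<^sub>m n" using schur[OF S] by blast
  have entry: "?s a b = (if a = b then c else 0)" if "a < n" "b < n" for a b
  proof -
    have "?s a b = S $$ (a, b)" using that by (simp add: S_def)
    then show ?thesis using that by (simp add: c)
  qed
  have "of_nat n * c = (\<Sum>a<n. ?s a a)"
    using entry by simp
  also have "\<dots> = (\<Sum>g\<in>carrier G. \<Sum>a<n. \<rho> (inv g) $$ (k, a) * \<rho> g $$ (a, j))"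
    by (subst sum.swap) (simp add: mult.commute)
  also have "\<dots> = (\<Sum>g\<in>carrier G. \<rho> (inv g \<otimes> g) $$ (k, j))"
    using ijkl by (intro sum.cong refl rep_mult_entry[symmetric]) auto
  also have "\<dots> = (\<Sum>g\<in>carrier G. if j = k then 1 else 0)"
    using ijkl by (intro sum.cong) (auto simp: rep_one)
  also have "\<dots> = (if j = k then of_nat (order G) else 0)"
    by (simp add: Coset.order_def)
  finally show ?thesis
    using entry[OF ijkl(1,4)] by auto
qed

lemma rep_center:
  assumes "z \<in> Z"
  obtains c where "\<rho> z = c \<cdot>\<^sub>m 1\<^sub>m n"
proof -
  have "\<rho> z * \<rho> g = \<rho> g * \<rho> z" if "g \<in> carrier G" for g
    using center_commute[OF assms that] rep_mult center_closed[OF assms] that by metis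
  then show ?thesis
    using schur[OF rep_carrier[OF center_closed[OF assms]]] that by blast
qed

text \<open>Any diagonal entry would do, since \<open>\<rho>\<close> is scalar on the center.\<close>

definition central_character :: "'a \<Rightarrow> 'k" where
  "central_character z = \<rho> z $$ (0, 0)"

lemma rep_center_eq:
  assumes "z \<in> Z"
  shows "\<rho> z = central_character z \<cdot>\<^sub>m 1\<^sub>m n"
proof -
  obtain c where "\<rho> z = c \<cdot>\<^sub>m 1\<^sub>m n" using rep_center[OF assms] .
  then show ?thesis using n_pos by (simp add: central_character_def)
qed

lemma rep_times_center:
  assumes "x \<in> carrier G" "z \<in> Z"
  shows "\<rho> (x \<otimes> z) = central_character z \<cdot>\<^sub>m \<rho> x"
  using assms center_closed rep_carrier[of x] rep_center_eq[of z]
    mult_smult_distrib[OF rep_carrier one_carrier_mat, of x "central_character z"]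
  by (simp add: rep_mult)

lemma central_character_mult:
  assumes "z \<in> Z" "w \<in> Z"
  shows "central_character (z \<otimes> w) = central_character z * central_character w"
  using rep_times_center[OF center_closed[OF assms(1)] assms(2)] n_pos rep_dim center_closed assms
  by (simp add: central_character_def mult.commute)

lemma central_character_one: "central_character \<one> = 1"
  using n_pos by (simp add: central_character_def rep_one)

lemma central_character_inv:
  "z \<in> Z \<Longrightarrow> central_character z * central_character (inv z) = 1"
  using central_character_mult[of z "inv z"] center_inv central_character_one center_closed by simp

lemma central_character_root_of_unity:
  assumes "z \<in> Z"
  shows "central_character z ^ order G = 1"
proof -
  have "central_character (z [^] m) = central_character z ^ m \<and> z [^] m \<in> Z" for m :: nat
    using assms by (induction m) (simp_all add: central_character_one central_character_mult center_mult center_one mult.commute)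
  then show ?thesis
    using pow_order_eq_1[OF center_closed[OF assms]] central_character_one by metis
qed

text \<open>The terms of the orthogonality relation are constant on cosets of \<open>Z\<close>, because the scalars of
  \<open>\<rho>(z)\<close> and \<open>\<rho>(z\<^sup>-\<^sup>1)\<close> cancel. So the relation becomes a matrix identity \<open>U V = 1\<close>, with matrix
  positions as rows of \<open>U\<close> and coset representatives as columns. The hypothesis on the index makes
  \<open>U\<close> square, whence \<open>V U = 1\<close>; the entry of \<open>V U\<close> at \<open>(s, t)\<close> is \<open>tr \<rho>(s\<^sup>-\<^sup>1 t) / n\<close>.\<close>

lemma central_type_trace_eq_0:
  assumes "n * n = card (rcosets Z)"
    and "x \<in> carrier G" "x \<notin> Z"
  shows "mat_trace (\<rho> x) = 0"
proof -
  define T where "T = coset_rep ` carrier G"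
  have "finite T" unfolding T_def using finite_carrier by simp
  have T: "t \<in> carrier G" if "t \<in> T" for t
    using that coset_rep_closed by (auto simp: T_def)
  define I where "I = {..<n} \<times> {..<n}"
  define U where "U = (\<lambda>(i, j) t. \<rho> t $$ (i, j))"
  define V where "V = (\<lambda>t (l, k). \<rho> (inv t) $$ (k, l) / of_nat n)"
  have cT: "card T = n * n" using card_coset_reps assms(1) T_def by simp
  have order: "order G = card Z * (n * n)"
    using lagrange[OF center_subgroup] assms(1) by (simp add: mult.commute)
  have UV: "(\<Sum>t\<in>T. U p t * V t q) = (if p = q then 1 else 0)" if pq: "p \<in> I" "q \<in> I" for p q
  proof -
    obtain i j l k where [simp]: "p = (i, j)" "q = (l, k)" by (cases p, cases q)
    have ijkl: "i < n" "j < n" "k < n" "l < n" using pq by (auto simp: I_def)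
    let ?h = "\<lambda>g. \<rho> g $$ (i, j) * \<rho> (inv g) $$ (k, l)"
    have "?h (y \<otimes> z) = ?h y" if yz: "y \<in> carrier G" "z \<in> Z" for y z
    proof -
      have "inv (y \<otimes> z) = inv y \<otimes> inv z"
        using yz center_closed center_commute[OF center_inv[of z], of "inv y"] by (simp add: inv_mult_group)
      then have "?h (y \<otimes> z) = (central_character z * central_character (inv z)) * ?h y"
        using yz ijkl center_inv[of z] rep_dim by (simp add: rep_times_center)
      then show ?thesis using central_character_inv yz by simp
    qed
    from sum_over_cosets[of ?h, OF this] 
    have "of_nat n * (of_nat (card Z) * (\<Sum>t\<in>T. ?h t)) = (if i = l \<and> j = k then of_nat (order G) else (0::'k))"
      using schur_orthogonality[OF ijkl] by (simp add: T_def)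
    then have eq: "of_nat (card Z) * of_nat n * (\<Sum>t\<in>T. ?h t) = of_nat (card Z) * of_nat n * (if p = q then of_nat n else (0::'k))"
      by (auto simp: order algebra_simps)
    have nz: "of_nat (card Z) * of_nat n \<noteq> (0::'k)"
      using card_center_pos n_pos by (simp add: of_nat_eq_0_iff_char_0)
    have "(\<Sum>t\<in>T. ?h t) = (if p = q then of_nat n else 0)"
      by (rule mult_left_cancel[THEN iffD1, OF nz eq])
    then show ?thesis
      using n_pos by (simp add: U_def V_def sum_divide_distrib[symmetric] of_nat_eq_0_iff_char_0)
  qed
  have "finite I" "card I = card T" by (simp_all add: I_def cT)
  have VU: "(\<Sum>p\<in>I. V s p * U p t) = (if s = t then 1 else 0)" if "s \<in> T" "t \<in> T" for s t
    by (rule finite_left_inverse_imp_right_inverse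
      [OF \<open>finite I\<close> \<open>finite T\<close> \<open>card I = card T\<close> UV that])
  have trace: "mat_trace (\<rho> (inv s \<otimes> t)) = 0" if st: "s \<in> T" "t \<in> T" "s \<noteq> t" for s t
  proof -
    have "0 = of_nat n * (\<Sum>p\<in>I. V s p * U p t)" using VU[OF st(1,2)] st(3) by simp
    also have "\<dots> = (\<Sum>i<n. \<Sum>j<n. \<rho> (inv s) $$ (j, i) * \<rho> t $$ (i, j))"
      using n_pos unfolding I_def sum.cartesian_product[symmetric]
      by (simp add: U_def V_def sum_distrib_left of_nat_eq_0_iff_char_0 case_prod_unfold
         sum.cartesian_product)
    also have "\<dots> = (\<Sum>j<n. \<rho> (inv s \<otimes> t) $$ (j, j))"
      using T st by (subst sum.swap) (simp add: rep_mult_entry)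
    finally show ?thesis
      using T st by (simp add: mat_trace_def rep_dim)
  qed
  \<comment> \<open>Up to central factors, which only change the trace by a nonzero scalar, \<open>x\<close> is a quotient of the
    representatives of \<open>Z\<close> and \<open>xZ\<close>.\<close>
  define s t where "s = coset_rep \<one>" and "t = coset_rep x"
  obtain z w where zw: "z \<in> Z" "s = \<one> \<otimes> z" "w \<in> Z" "t = x \<otimes> w"
    using coset_repE[of \<one>] coset_repE[of x] unfolding s_def t_def by metis
  have "s \<noteq> t"
  proof
    assume "s = t"
    then have "z = x \<otimes> w" using zw center_closed by simp
    then have "x = z \<otimes> inv w" using zw center_closed assms(2) by (simp add: m_assoc)
    then show False using zw center_mult center_inv assms(3) by blast
  qed
  have "inv s \<otimes> t = x \<otimes> (inv z \<otimes> w)"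
    using zw assms(2) center_closed center_inv center_commute[of "inv z" x]
    by (simp add: m_assoc[symmetric])
  then have "mat_trace (\<rho> (x \<otimes> (inv z \<otimes> w))) = 0"
    using trace[OF _ _ \<open>s \<noteq> t\<close>] assms(2) by (simp add: s_def t_def T_def)
  then have "central_character (inv z \<otimes> w) * mat_trace (\<rho> x) = 0"
    using assms(2) zw center_mult center_inv rep_dim
    by (simp add: rep_times_center mat_trace_def sum_distrib_left)
  moreover have "central_character (inv z \<otimes> w) \<noteq> 0"
    using central_character_inv[of "inv z \<otimes> w"] zw center_mult center_inv by auto
  ultimately show ?thesis by simp
qed

lemma trace_center:
  "z \<in> Z \<Longrightarrow> mat_trace (\<rho> z) = of_nat n * central_character z"
  by (simp add: rep_center_eq mat_trace_def)

text \<open>On the center the coefficient \<open>n\<^sup>2 \<lambda>(x\<^sup>-\<^sup>1) / |G|\<close> equals \<open>\<lambda>(x\<^sup>-\<^sup>1) / |Z|\<close> because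
  \<open>|G| = |Z| n\<^sup>2\<close>; elsewhere it is zero because the character vanishes.\<close>

lemma central_type_char_idempotent:
  assumes \<chi>: "\<chi> = (\<lambda>g\<in>carrier G. mat_trace (\<rho> g))" and "central_type G \<chi>"
  shows "char_idempotent G \<chi> =
    (\<lambda>x. if x \<in> Z then central_character (inv x) / of_nat (card Z) else 0)"
proof -
  have deg: "\<chi> \<one> = of_nat n"
    by (simp add: \<chi> rep_one mat_trace_def)
  have "of_nat (n * n) = (of_nat (card (rcosets Z)) :: 'k)"
    using assms(2) unfolding central_type_def deg by (simp add: power2_eq_square)
  then have index: "n * n = card (rcosets Z)"
    by (simp only: of_nat_eq_iff_char_0)
  have order: "order G = card Z * (n * n)"
    using lagrange[OF center_subgroup] index by (simp add: mult.commute)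
  show ?thesis
  proof
    fix x
    show "char_idempotent G \<chi> x = (if x \<in> Z then central_character (inv x) / of_nat (card Z) else 0)"
    proof (cases "x \<in> Z")
      case True
      then have "\<chi> (inv x) = of_nat n * central_character (inv x)"
        using center_inv center_closed by (simp add: \<chi> trace_center)
      then show ?thesis
        using True center_closed n_pos card_center_pos
        by (simp add: char_idempotent_def deg order of_nat_eq_0_iff_char_0 field_simps)
    next
      case False
      have "\<chi> (inv x) = 0" if x: "x \<in> carrier G"
      proof -
        have "inv x \<notin> Z" using False x center_inv[of "inv x"] by auto
        then show ?thesis using x central_type_trace_eq_0[OF index] by (simp add: \<chi>)
      qed
      then show ?thesis using False by (simp add: char_idempotent_def)
    qed
  qed
qed

end

section \<open>The algebra of an integral central character\<close>

text \<open>The setting that remains of a character of central type: a linear character \<open>l\<close> of the center with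
  values in \<open>\<O>\<close>, such that the idempotent of \<open>\<chi>\<close> is the one belonging to \<open>l\<close>.\<close>

locale central_idempotent = finite_group G for G :: "('g, 'x) monoid_scheme" (structure) +
  fixes l :: "'g \<Rightarrow> 'o::idom" and \<chi> :: "'g \<Rightarrow> 'o fract"
  assumes l_one: "l \<one> = 1"
    and l_mult: "\<And>z w. z \<in> Z \<Longrightarrow> w \<in> Z \<Longrightarrow> l (z \<otimes> w) = l z * l w"
    and card_center_nonzero: "of_nat (card Z) \<noteq> (0 :: 'o fract)"
    and char_idempotent_eq: "char_idempotent G \<chi> =
      (\<lambda>x. if x \<in> Z then to_fract (l (inv x)) / of_nat (card Z) else 0)"
begin

abbreviation "N \<equiv> (of_nat (card Z) :: 'o fract)"
abbreviation "e \<equiv> char_idempotent G \<chi>"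
abbreviation "A \<equiv> char_algebra G \<chi>"

abbreviation conv :: "('g \<Rightarrow> 'o fract) \<Rightarrow> ('g \<Rightarrow> 'o fract) \<Rightarrow> 'g \<Rightarrow> 'o fract" (infixl "\<star>" 70)
  where "f \<star> g \<equiv> mult (group_algebra G :: ('o fract, 'g \<Rightarrow> 'o fract) module) f g"

lemma l_inv: "z \<in> Z \<Longrightarrow> l z * l (inv z) = 1"
  using l_mult[of z "inv z"] center_inv l_one center_closed by simp

lemma conv_apply:
  "(f \<star> g) x = (if x \<in> carrier G then \<Sum>y\<in>carrier G. f y * g (inv y \<otimes> x) else 0)"
  by (simp add: group_algebra_def)

lemma conv_assoc: "f \<star> g \<star> h = f \<star> (g \<star> h)"
proof
  fix x
  show "(f \<star> g \<star> h) x = (f \<star> (g \<star> h)) x"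
  proof (cases "x \<in> carrier G")
    case x: True
    have "(f \<star> g \<star> h) x = (\<Sum>y\<in>carrier G. \<Sum>w\<in>carrier G. f w * g (inv w \<otimes> y) * h (inv y \<otimes> x))"
      using x by (simp add: conv_apply sum_distrib_right)
    also have "\<dots> = (\<Sum>w\<in>carrier G. \<Sum>y\<in>carrier G. f w * g (inv w \<otimes> y) * h (inv y \<otimes> x))"
      by (rule sum.swap)
    also have "\<dots> = (\<Sum>w\<in>carrier G. \<Sum>y\<in>carrier G. f w * g (inv w \<otimes> (w \<otimes> y)) * h (inv (w \<otimes> y) \<otimes> x))"
    proof (rule sum.cong[OF refl])
      fix w assume w: "w \<in> carrier G"
      show "(\<Sum>y\<in>carrier G. f w * g (inv w \<otimes> y) * h (inv y \<otimes> x)) =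
        (\<Sum>y\<in>carrier G. f w * g (inv w \<otimes> (w \<otimes> y)) * h (inv (w \<otimes> y) \<otimes> x))"
        by (rule sum_left_translate[OF w, symmetric])
    qed
    also have "\<dots> = (\<Sum>w\<in>carrier G. f w * (\<Sum>y\<in>carrier G. g y * h (inv y \<otimes> (inv w \<otimes> x))))"
      unfolding sum_distrib_left
    proof (intro sum.cong refl)
      fix w y assume wy: "w \<in> carrier G" "y \<in> carrier G"
      have "inv w \<otimes> (w \<otimes> y) = y" using wy by (simp flip: m_assoc)
      moreover have "inv (w \<otimes> y) \<otimes> x = inv y \<otimes> (inv w \<otimes> x)"
        using wy x by (simp add: inv_mult_group m_assoc)
      ultimately show "f w * g (inv w \<otimes> (w \<otimes> y)) * h (inv (w \<otimes> y) \<otimes> x) =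
        f w * (g y * h (inv y \<otimes> (inv w \<otimes> x)))" by (simp add: mult.assoc)
    qed
    also have "\<dots> = (f \<star> (g \<star> h)) x"
      using x by (simp add: conv_apply)
    finally show ?thesis .
  qed (simp add: conv_apply)
qed

lemma conv_add_left: "(\<lambda>x. f x + g x) \<star> h = (\<lambda>x. (f \<star> h) x + (g \<star> h) x)"
  by (rule ext) (simp add: conv_apply sum.distrib algebra_simps)

lemma conv_add_right: "h \<star> (\<lambda>x. f x + g x) = (\<lambda>x. (h \<star> f) x + (h \<star> g) x)"
  by (rule ext) (simp add: conv_apply sum.distrib algebra_simps)

lemma conv_scale_left: "(\<lambda>x. c * f x) \<star> h = (\<lambda>x. c * (f \<star> h) x)"
  by (rule ext) (simp add: conv_apply sum_distrib_left algebra_simps)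

lemma conv_scale_right: "h \<star> (\<lambda>x. c * f x) = (\<lambda>x. c * (h \<star> f) x)"
  by (rule ext) (simp add: conv_apply sum_distrib_left algebra_simps)

text \<open>The coefficient of the identity is a trace form on every group algebra: both sides are
  \<open>\<Sum>\<^sub>y f(y) g(y\<^sup>-\<^sup>1)\<close>, summed in a different order.\<close>

lemma conv_one_commute: "(f \<star> g) \<one> = (g \<star> f) \<one>"
proof -
  have "(f \<star> g) \<one> = (\<Sum>y\<in>carrier G. f (inv y) * g (inv (inv y)))"
    using sum_inverse[of "\<lambda>y. f y * g (inv y)"] by (simp add: conv_apply)
  also have "\<dots> = (g \<star> f) \<one>"
    by (simp add: conv_apply mult.commute)
  finally show ?thesis .
qed

lemma sum_center_indicator:
  "(\<Sum>y\<in>carrier G. if y \<in> Z then f y else (0 :: 'o fract)) = (\<Sum>z\<in>Z. f z)"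
proof -
  have "carrier G \<inter> Z = Z" using center_closed by blast
  then show ?thesis
    using sum.inter_restrict[OF finite_carrier, of f Z] by simp
qed

lemma inv_in_center_iff: "x \<in> carrier G \<Longrightarrow> inv x \<in> Z \<longleftrightarrow> x \<in> Z"
  using center_inv[of x] center_inv[of "inv x"] by auto

lemma conv_idempotent:
  assumes x: "x \<in> carrier G"
  shows "(f \<star> e) x = (\<Sum>z\<in>Z. f (x \<otimes> z) * to_fract (l z)) / N"
proof -
  have "(f \<star> e) x = (\<Sum>y\<in>carrier G. f (x \<otimes> y) * e (inv (x \<otimes> y) \<otimes> x))"
    using sum_left_translate[OF x, of "\<lambda>y. f y * e (inv y \<otimes> x)"] x by (simp add: conv_apply)
  also have "\<dots> = (\<Sum>y\<in>carrier G. if y \<in> Z then f (x \<otimes> y) * to_fract (l y) / N else 0)"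
  proof (rule sum.cong[OF refl])
    fix y assume y: "y \<in> carrier G"
    have "inv (x \<otimes> y) \<otimes> x = inv y" using x y by (simp add: inv_mult_group m_assoc)
    then show "f (x \<otimes> y) * e (inv (x \<otimes> y) \<otimes> x) =
      (if y \<in> Z then f (x \<otimes> y) * to_fract (l y) / N else 0)"
      using y by (simp add: char_idempotent_eq inv_in_center_iff)
  qed
  also have "\<dots> = (\<Sum>z\<in>Z. f (x \<otimes> z) * to_fract (l z)) / N"
    by (simp add: sum_center_indicator sum_divide_distrib)
  finally show ?thesis .
qed

text \<open>The functions fixed by multiplication with the idempotent, described without reference to the
  multiplication.\<close>

definition equivariant :: "('g \<Rightarrow> 'o fract) \<Rightarrow> bool" where
  "equivariant f \<longleftrightarrow> (\<forall>x. x \<notin> carrier G \<longrightarrow> f x = 0) \<and>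
    (\<forall>x\<in>carrier G. \<forall>z\<in>Z. f (x \<otimes> z) = to_fract (l (inv z)) * f x)"

text \<open>Multiplication by \<open>|Z|\<close> clears the denominator of the idempotent; \<open>carrier_char_algebra\<close> shows
  that this is the underlying set of \<open>\<O>Ge(\<chi>)\<close>.\<close>

definition char_lattice :: "('g \<Rightarrow> 'o fract) set" where
  "char_lattice = {f. equivariant f \<and> (\<forall>x. N * f x \<in> range to_fract)}"

lemma to_fract_l_inv: "z \<in> Z \<Longrightarrow> to_fract (l z) * to_fract (l (inv z)) = 1"
  using l_inv by (metis to_fract_1 to_fract_mult)

lemma equivariant_idempotent_right:
  assumes "equivariant f"
  shows "f \<star> e = f"
proof
  fix x
  show "(f \<star> e) x = f x"
  proof (cases "x \<in> carrier G")
    case x: True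
    have "(\<Sum>z\<in>Z. f (x \<otimes> z) * to_fract (l z)) = (\<Sum>z\<in>Z. f x)"
    proof (rule sum.cong[OF refl])
      fix z assume z: "z \<in> Z"
      have "f (x \<otimes> z) * to_fract (l z) = (to_fract (l z) * to_fract (l (inv z))) * f x"
        using assms x z by (simp add: equivariant_def)
      then show "f (x \<otimes> z) * to_fract (l z) = f x" using to_fract_l_inv[OF z] by simp
    qed
    then show ?thesis using x card_center_nonzero by (simp add: conv_idempotent)
  qed (use assms in \<open>simp add: conv_apply equivariant_def\<close>)
qed

lemma idempotent_central: "e \<star> f = f \<star> e"
proof
  fix x
  show "(e \<star> f) x = (f \<star> e) x"
  proof (cases "x \<in> carrier G")
    case x: True
    have "(e \<star> f) x = (\<Sum>y\<in>carrier G. if y \<in> Z then to_fract (l (inv y)) / N * f (inv y \<otimes> x) else 0)"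
      using x by (auto simp: conv_apply char_idempotent_eq intro!: sum.cong)
    also have "\<dots> = (\<Sum>y\<in>carrier G. if inv y \<in> Z then to_fract (l (inv (inv y))) / N * f (inv (inv y) \<otimes> x) else 0)"
      by (rule sum_inverse[symmetric])
    also have "\<dots> = (\<Sum>y\<in>carrier G. if y \<in> Z then f (x \<otimes> y) * to_fract (l y) / N else 0)"
      using x by (intro sum.cong) (auto simp: inv_in_center_iff center_commute[OF _ x])
    also have "\<dots> = (f \<star> e) x"
      using x by (simp add: conv_idempotent sum_center_indicator sum_divide_distrib)
    finally show ?thesis .
  qed (simp add: conv_apply)
qed

lemma equivariant_conv:
  assumes "equivariant g"
  shows "equivariant (f \<star> g)"
  unfolding equivariant_def
proof (intro conjI allI ballI impI)
  fix x z assume x: "x \<in> carrier G" and z: "z \<in> Z"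
  have "f y * g (inv y \<otimes> (x \<otimes> z)) = to_fract (l (inv z)) * (f y * g (inv y \<otimes> x))"
    if y: "y \<in> carrier G" for y
  proof -
    have "g (inv y \<otimes> x \<otimes> z) = to_fract (l (inv z)) * g (inv y \<otimes> x)"
      using assms x y z by (simp add: equivariant_def)
    then show ?thesis using x y z center_closed by (simp add: m_assoc)
  qed
  note sum.cong[OF refl this]
  then show "(f \<star> g) (x \<otimes> z) = to_fract (l (inv z)) * (f \<star> g) x"
    using x z center_closed by (simp only: conv_apply m_closed if_True sum_distrib_left)
qed (simp add: conv_apply)

lemma equivariant_idempotent: "equivariant e"
  unfolding equivariant_def
proof (intro conjI allI ballI impI)
  show "e x = 0" if "x \<notin> carrier G" for x
    using that center_closed by (auto simp: char_idempotent_eq)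
next
  fix x z assume x: "x \<in> carrier G" and z: "z \<in> Z"
  show "e (x \<otimes> z) = to_fract (l (inv z)) * e x"
  proof (cases "x \<in> Z")
    case True
    then have "inv (x \<otimes> z) = inv z \<otimes> inv x"
      using z center_closed by (simp add: inv_mult_group)
    then show ?thesis
      using True z center_mult center_inv by (simp add: char_idempotent_eq l_mult)
  next
    case False
    have "x \<otimes> z \<notin> Z"
    proof
      assume "x \<otimes> z \<in> Z"
      then have "x \<otimes> z \<otimes> inv z \<in> Z" using z center_mult center_inv by blast
      then show False using False x z center_closed by (simp add: m_assoc)
    qed
    then show ?thesis using False by (simp add: char_idempotent_eq)
  qed
qed

lemma range_to_fract_0: "0 \<in> range (to_fract :: 'o \<Rightarrow> _)"
  by (metis rangeI to_fract_0)

lemma range_to_fract_add: "a \<in> range to_fract \<Longrightarrow> b \<in> range to_fract \<Longrightarrow> a + b \<in> range (to_fract :: 'o \<Rightarrow> _)"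
  by (auto simp flip: to_fract_add)

lemma range_to_fract_mult: "a \<in> range to_fract \<Longrightarrow> b \<in> range to_fract \<Longrightarrow> a * b \<in> range (to_fract :: 'o \<Rightarrow> _)"
  by (auto simp flip: to_fract_mult)

lemma range_to_fract_sum: "(\<And>i. i \<in> I \<Longrightarrow> f i \<in> range to_fract) \<Longrightarrow> sum f I \<in> range (to_fract :: 'o \<Rightarrow> _)"
  by (induction I rule: infinite_finite_induct)
    (auto intro!: range_to_fract_add range_to_fract_0)

lemma lattice_equivariant: "f \<in> char_lattice \<Longrightarrow> equivariant f"
  by (simp add: char_lattice_def)

lemma lattice_zero_outside: "f \<in> char_lattice \<Longrightarrow> x \<notin> carrier G \<Longrightarrow> f x = 0"
  by (simp add: char_lattice_def equivariant_def)

lemma lattice_integral: "f \<in> char_lattice \<Longrightarrow> N * f x \<in> range to_fract"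
  by (simp add: char_lattice_def)

lemma lattice_idempotent: "e \<in> char_lattice"
proof -
  have "N * e x \<in> range to_fract" for x
    using card_center_nonzero by (simp add: char_idempotent_eq range_to_fract_0)
  then show ?thesis using equivariant_idempotent by (simp add: char_lattice_def)
qed

lemma integral_conv_lattice:
  assumes "g \<in> char_lattice"
  shows "(to_fract \<circ> a) \<star> g \<in> char_lattice"
proof -
  have "N * ((to_fract \<circ> a) \<star> g) x \<in> range to_fract" for x
  proof (cases "x \<in> carrier G")
    case True
    then have "N * ((to_fract \<circ> a) \<star> g) x = (\<Sum>y\<in>carrier G. to_fract (a y) * (N * g (inv y \<otimes> x)))"
      by (simp add: conv_apply sum_distrib_left mult.left_commute)
    also have "\<dots> \<in> range to_fract"
      using assms by (intro range_to_fract_sum range_to_fract_mult lattice_integral) auto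
    finally show ?thesis .
  qed (simp add: conv_apply range_to_fract_0)
  then show ?thesis
    using equivariant_conv lattice_equivariant[OF assms] by (simp add: char_lattice_def)
qed

definition integer_part :: "'o fract \<Rightarrow> 'o" where
  "integer_part = the_inv to_fract"

lemma integer_part_to_fract [simp]: "integer_part (to_fract c) = c"
  unfolding integer_part_def by (rule the_inv_f_f) (simp add: inj_on_def)

lemma to_fract_integer_part: "a \<in> range to_fract \<Longrightarrow> to_fract (integer_part a) = a"
  by auto

text \<open>A preimage in \<open>\<O>G\<close> of \<open>f\<close> under multiplication by the idempotent. It is supported on
  the coset representatives, which makes it unique, hence linear in \<open>f\<close>: it is a section of the
  projection of \<open>\<O>G\<close> onto \<open>\<O>Ge(\<chi>)\<close>.\<close>

definition coordinates :: "('g \<Rightarrow> 'o fract) \<Rightarrow> 'g \<Rightarrow> 'o" where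
  "coordinates f x = (if x \<in> carrier G \<and> coset_rep x = x then integer_part (N * f x) else 0)"

text \<open>The value at \<open>x\<close> of the product with the idempotent averages over the coset \<open>xZ\<close>, where the only
  nonzero coordinate sits at the representative; equivariance transports it back to \<open>x\<close>.\<close>

lemma coordinates_conv_idempotent:
  assumes f: "f \<in> char_lattice"
  shows "(to_fract \<circ> coordinates f) \<star> e = f"
proof
  fix x
  show "((to_fract \<circ> coordinates f) \<star> e) x = f x"
  proof (cases "x \<in> carrier G")
    case x: True
    obtain z where z: "z \<in> Z" "coset_rep x = x \<otimes> z" by (rule coset_repE)
    have "to_fract (coordinates f (x \<otimes> w)) * to_fract (l w) = (if w = z then N * f x else 0)"
      if w: "w \<in> Z" for w
    proof (cases "w = z")
      case True
      have "f (x \<otimes> z) = to_fract (l (inv z)) * f x"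
        using lattice_equivariant[OF f] x z by (simp add: equivariant_def)
      moreover have "coset_rep (x \<otimes> z) = x \<otimes> z"
        using x z coset_rep_mult_center by simp
      ultimately have "to_fract (coordinates f (x \<otimes> z)) * to_fract (l z) =
          N * f x * (to_fract (l z) * to_fract (l (inv z)))"
        using x z center_closed lattice_integral[OF f, of "x \<otimes> z"]
        by (simp add: coordinates_def to_fract_integer_part)
      then show ?thesis using True to_fract_l_inv z by simp
    next
      case False
      then have "coset_rep (x \<otimes> w) \<noteq> x \<otimes> w"
        using x z w coset_rep_mult_center center_closed by simp
      then show ?thesis using False by (simp add: coordinates_def)
    qed
    then have "(\<Sum>w\<in>Z. to_fract (coordinates f (x \<otimes> w)) * to_fract (l w)) = N * f x"
      using z finite_center by simp
    then show ?thesis using x card_center_nonzero by (simp add: conv_idempotent)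
  qed (use lattice_zero_outside[OF f] in \<open>simp add: conv_apply\<close>)
qed

lemma char_algebra_simps:
  "x \<otimes>\<^bsub>A\<^esub> y = x \<star> y"
  "\<one>\<^bsub>A\<^esub> = e"
  "\<zero>\<^bsub>A\<^esub> = (\<lambda>x. 0)"
  "f \<oplus>\<^bsub>A\<^esub> g = (\<lambda>x. f x + g x)"
  "c \<odot>\<^bsub>A\<^esub> f = (\<lambda>x. to_fract c * f x)"
  by (simp_all add: char_algebra_def Let_def group_algebra_def)

lemma carrier_char_algebra_eq:
  "carrier A = {(to_fract \<circ> a) \<star> e |a. \<forall>x. x \<notin> carrier G \<longrightarrow> a x = 0}"
  by (simp add: char_algebra_def Let_def group_algebra_def)

lemma carrier_char_algebra: "carrier A = char_lattice"
proof (intro equalityI subsetI)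
  fix f assume "f \<in> carrier A"
  then show "f \<in> char_lattice"
    using integral_conv_lattice[OF lattice_idempotent] by (auto simp: carrier_char_algebra_eq)
next
  fix f assume "f \<in> char_lattice"
  then have "f = (to_fract \<circ> coordinates f) \<star> e"
    using coordinates_conv_idempotent by simp
  moreover have "\<forall>x. x \<notin> carrier G \<longrightarrow> coordinates f x = 0"
    by (simp add: coordinates_def)
  ultimately show "f \<in> carrier A"
    unfolding carrier_char_algebra_eq by blast
qed

text \<open>The denominators \<open>|Z|\<close> of the two factors do not accumulate: as \<open>f = a e\<close> with \<open>a \<in> \<O>G\<close>, the
  product is \<open>f g = a (e g) = a g\<close>.\<close>

lemma lattice_conv:
  assumes f: "f \<in> char_lattice" and g: "g \<in> char_lattice"
  shows "f \<star> g \<in> char_lattice"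
proof -
  have "f \<star> g = (to_fract \<circ> coordinates f) \<star> (e \<star> g)"
    using coordinates_conv_idempotent[OF f] by (metis conv_assoc)
  also have "e \<star> g = g"
    using equivariant_idempotent_right lattice_equivariant g idempotent_central by metis
  finally show ?thesis by (metis integral_conv_lattice[OF g])
qed

lemma lattice_add: "f \<in> char_lattice \<Longrightarrow> g \<in> char_lattice \<Longrightarrow> (\<lambda>x. f x + g x) \<in> char_lattice"
  by (auto simp: char_lattice_def equivariant_def distrib_left intro!: range_to_fract_add)

lemma lattice_scale: "f \<in> char_lattice \<Longrightarrow> (\<lambda>x. to_fract c * f x) \<in> char_lattice"
  unfolding char_lattice_def equivariant_def
  using range_to_fract_mult[of "to_fract c"] by (auto simp: mult.left_commute)

lemma lattice_zero: "(\<lambda>x. 0) \<in> char_lattice"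
  by (simp add: char_lattice_def equivariant_def range_to_fract_0)

lemma lattice_uminus: "f \<in> char_lattice \<Longrightarrow> (\<lambda>x. - f x) \<in> char_lattice"
  using lattice_scale[of f "-1"] by simp

lemma abelian_group_char_algebra: "abelian_group A"
proof (rule abelian_groupI)
  fix f assume "f \<in> carrier A"
  then show "\<exists>g\<in>carrier A. g \<oplus>\<^bsub>A\<^esub> f = \<zero>\<^bsub>A\<^esub>"
    by (intro bexI[of _ "\<lambda>x. - f x"]) (simp_all add: char_algebra_simps carrier_char_algebra lattice_uminus)
qed (simp_all add: char_algebra_simps carrier_char_algebra lattice_add lattice_zero add_ac)

lemma ring_char_algebra: "ring A"
proof (rule ringI)
  show "monoid A"
    by (rule monoidI)
      (simp_all add: char_algebra_simps carrier_char_algebra lattice_conv lattice_idempotent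
        conv_assoc idempotent_central equivariant_idempotent_right lattice_equivariant)
qed (simp_all add: abelian_group_char_algebra char_algebra_simps conv_add_left conv_add_right)

lemma module_char_algebra: "module (class_ring :: 'o ring) A"
  by (rule moduleI)
    (simp_all add: abelian_group_char_algebra class_cring.cring_axioms char_algebra_simps
      carrier_char_algebra lattice_scale distrib_left distrib_right mult.assoc)

lemma associative_algebra_char_algebra: "associative_algebra (class_ring :: 'o ring) A"
  by (simp add: associative_algebra_def ring_char_algebra module_char_algebra char_algebra_simps
      conv_scale_left conv_scale_right)

text \<open>The image \<open>u e(\<chi>)\<close> of a group element. These images span the algebra over \<open>\<O>\<close>, and elements of
  the same coset of \<open>Z\<close> give the same image up to a unit of \<open>\<O>\<close>.\<close>

definition group_element :: "'g \<Rightarrow> 'g \<Rightarrow> 'o fract" where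
  "group_element u = (\<lambda>x. if x = u then 1 else 0) \<star> e"

lemma group_element_eq:
  "group_element u = (to_fract \<circ> (\<lambda>x. if x = u then 1 else 0)) \<star> e"
  unfolding group_element_def by (rule arg_cong2[where f = "(\<star>)"]) auto

lemma group_element_lattice: "group_element u \<in> char_lattice"
  unfolding group_element_eq by (rule integral_conv_lattice[OF lattice_idempotent])

lemma group_element_center:
  assumes u: "u \<in> carrier G" and z: "z \<in> Z"
  shows "group_element (u \<otimes> z) = (\<lambda>x. to_fract (l z) * group_element u x)"
proof -
  show ?thesis
  proof
    fix x
    show "group_element (u \<otimes> z) x = to_fract (l z) * group_element u x"
    proof (cases "x \<in> carrier G")
      case x: True
      have "group_element v x = e (inv v \<otimes> x)" if v: "v \<in> carrier G" for v
        using x v finite_carrier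
        by (simp add: group_element_def conv_apply if_distrib[of "\<lambda>a. a * _"] sum.delta cong: if_cong)
      moreover have "inv (u \<otimes> z) \<otimes> x = inv u \<otimes> x \<otimes> inv z"
        using x u z center_closed center_commute[OF center_inv[OF z], of "inv u \<otimes> x"]
        by (simp add: inv_mult_group m_assoc)
      moreover have "e (inv u \<otimes> x \<otimes> inv z) = to_fract (l (inv (inv z))) * e (inv u \<otimes> x)"
        using equivariant_idempotent x u z center_inv by (simp add: equivariant_def)
      ultimately show ?thesis using u z center_closed by simp
    qed (simp add: group_element_def conv_apply)
  qed
qed

text \<open>The elements \<open>u e(\<chi>)\<close> read off values: \<open>f u e = f u\<close> as \<open>e\<close> is central and fixes \<open>f\<close>, and the
  coefficient of \<open>f u\<close> at the identity is \<open>f(u\<^sup>-\<^sup>1)\<close>.\<close>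

lemma conv_group_element_one:
  assumes f: "f \<in> char_lattice" and u: "u \<in> carrier G"
  shows "(f \<star> group_element u) \<one> = f (inv u)"
proof -
  let ?d = "\<lambda>x. if x = u then 1 else 0 :: 'o fract"
  have "f \<star> group_element u = f \<star> (e \<star> ?d)"
    by (simp add: group_element_def idempotent_central)
  also have "\<dots> = f \<star> ?d"
    using equivariant_idempotent_right[OF lattice_equivariant[OF f]] by (simp flip: conv_assoc)
  finally have "(f \<star> group_element u) \<one> = (?d \<star> f) \<one>"
    using conv_one_commute by simp
  also have "\<dots> = f (inv u)"
    using u finite_carrier
    by (simp add: conv_apply if_distrib[of "\<lambda>a. a * _"] sum.delta cong: if_cong)
  finally show ?thesis .
qed

text \<open>The induction principle for the \<open>\<O>\<close>-span of the elements \<open>u e(\<chi>)\<close>. Its proof adds the group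
  elements in the support of the coordinates of \<open>f\<close> one at a time.\<close>

lemma char_lattice_induct [consumes 1, case_names zero add scale generator]:
  assumes f: "f \<in> char_lattice"
    and zero: "P (\<lambda>x. 0)"
    and add: "\<And>f g. f \<in> char_lattice \<Longrightarrow> g \<in> char_lattice \<Longrightarrow> P f \<Longrightarrow> P g \<Longrightarrow> P (\<lambda>x. f x + g x)"
    and scale: "\<And>c f. f \<in> char_lattice \<Longrightarrow> P f \<Longrightarrow> P (\<lambda>x. to_fract c * f x)"
    and generator: "\<And>u. u \<in> carrier G \<Longrightarrow> P (group_element u)"
  shows "P f"
proof -
  have "P ((to_fract \<circ> (\<lambda>x. if x \<in> S then a x else 0)) \<star> e)"
    if "finite S" "S \<subseteq> carrier G" for S a
    using that
  proof (induction S)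
    case empty
    have "(to_fract \<circ> (\<lambda>x. if x \<in> {} then a x else 0)) \<star> e = (\<lambda>x. 0)"
      by (rule ext) (simp add: conv_apply)
    then show ?case using zero by (simp only:)
  next
    case (insert u S)
    let ?r = "(to_fract \<circ> (\<lambda>x. if x \<in> S then a x else 0)) \<star> e"
    have "to_fract \<circ> (\<lambda>x. if x \<in> insert u S then a x else 0) =
      (\<lambda>x. to_fract (a u) * (if x = u then 1 else 0) + (to_fract \<circ> (\<lambda>x. if x \<in> S then a x else 0)) x)"
      using insert.hyps by auto
    then have "(to_fract \<circ> (\<lambda>x. if x \<in> insert u S then a x else 0)) \<star> e =
      (\<lambda>x. to_fract (a u) * group_element u x + ?r x)"
      by (simp only: conv_add_left conv_scale_left group_element_def)
    moreover have "P (\<lambda>x. to_fract (a u) * group_element u x + ?r x)"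
    proof (rule add)
      show "P ?r" using insert.prems by (intro insert.IH) simp
      show "P (\<lambda>x. to_fract (a u) * group_element u x)"
        using insert.prems by (intro scale generator group_element_lattice) simp
    qed (intro lattice_scale group_element_lattice integral_conv_lattice lattice_idempotent)+
    ultimately show ?case by (simp only:)
  qed
  from this[OF finite_carrier subset_refl, of "coordinates f"]
  have "P ((to_fract \<circ> (\<lambda>x. if x \<in> carrier G then coordinates f x else 0)) \<star> e)" .
  moreover have "(\<lambda>x. if x \<in> carrier G then coordinates f x else 0) = coordinates f"
    by (auto simp: coordinates_def)
  ultimately show ?thesis
    by (simp only: coordinates_conv_idempotent[OF f])
qed

section \<open>Finite generation and projectivity\<close>

lemma finitely_generated_char_algebra:
  "finitely_generated_module (class_ring :: 'o ring) A"
  unfolding finitely_generated_module_def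
proof (intro exI conjI)
  interpret M: module "class_ring :: 'o ring" A by (rule module_char_algebra)
  let ?S = "group_element ` carrier G"
  show "finite ?S" using finite_carrier by simp
  show S: "?S \<subseteq> carrier A"
    using group_element_lattice by (auto simp: carrier_char_algebra)
  have sub: "submodule (class_ring :: 'o ring) (M.span ?S) A"
    by (rule M.span_is_submodule[OF S])
  have gen: "group_element u \<in> M.span ?S" if "u \<in> carrier G" for u
    using M.in_own_span[OF S] that by blast
  show "M.span ?S = carrier A"
  proof (intro equalityI subsetI)
    fix f assume "f \<in> M.span ?S"
    then show "f \<in> carrier A" using M.span_is_subset2[OF S] by blast
  next
    fix f assume "f \<in> carrier A"
    then have "f \<in> char_lattice" by (simp add: carrier_char_algebra)
    then show "f \<in> M.span ?S"
    proof (induction rule: char_lattice_induct)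
      case zero
      have "\<zero>\<^bsub>A\<^esub> \<in> M.span ?S" using sub by (simp add: submodule_def)
      then show ?case by (simp add: char_algebra_simps)
    next
      case (add f g)
      then have "f \<oplus>\<^bsub>A\<^esub> g \<in> M.span ?S" using sub by (simp add: submodule_def)
      then show ?case by (simp add: char_algebra_simps)
    next
      case (scale c f)
      then have "c \<odot>\<^bsub>A\<^esub> f \<in> M.span ?S" using sub by (simp add: submodule_def)
      then show ?case by (simp add: char_algebra_simps)
    qed (rule gen)
  qed
qed

text \<open>The coordinates split the projection \<open>a \<mapsto> a e(\<chi>)\<close> from the free module \<open>\<O>G\<close>. To index its basis
  by elements of the type of the algebra, \<open>u \<in> G\<close> is replaced by its indicator function \<open>d u\<close>.\<close>

lemma projective_char_algebra: "projective_module (class_ring :: 'o ring) A"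
proof -
  let ?R = "class_ring :: 'o ring"
  define d where "d = (\<lambda>u x :: 'g. if x = u then 1 else 0 :: 'o fract)"
  have d: "d u = d v \<longleftrightarrow> u = v" for u v
    unfolding d_def by (metis zero_neq_one)
  define I where "I = d ` carrier G"
  define \<iota> where "\<iota> = (\<lambda>f i. if i \<in> I then coordinates f (the_inv d i) else 0)"
  define \<pi> where "\<pi> = (\<lambda>h. (to_fract \<circ> (\<lambda>u. if u \<in> carrier G then h (d u) else 0)) \<star> e)"
  have inv_d: "the_inv d (d u) = u" for u
    by (rule the_inv_f_f) (simp add: inj_on_def d)
  have finite_I: "finite I" by (simp add: I_def finite_carrier)
  have coordinates_add: "coordinates (\<lambda>x. f x + g x) u = coordinates f u + coordinates g u"
    if fg: "f \<in> char_lattice" "g \<in> char_lattice" for f g u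
  proof -
    obtain a b where "N * f u = to_fract a" "N * g u = to_fract b"
      using lattice_integral[OF fg(1), of u] lattice_integral[OF fg(2), of u] by blast
    moreover from this have "N * (f u + g u) = to_fract (a + b)" by (simp add: distrib_left)
    ultimately show ?thesis by (simp add: coordinates_def del: to_fract_add)
  qed
  have coordinates_scale: "coordinates (\<lambda>x. to_fract c * f x) u = c * coordinates f u"
    if f: "f \<in> char_lattice" for f c u
  proof -
    obtain a where "N * f u = to_fract a"
      using lattice_integral[OF f, of u] by blast
    moreover from this have "N * (to_fract c * f u) = to_fract (c * a)" by (simp add: mult.left_commute)
    ultimately show ?thesis by (simp add: coordinates_def del: to_fract_mult)
  qed
  have "\<iota> \<in> module_hom ?R A (free_module ?R I)"
    unfolding module_hom_def free_module_def
    using finite_I finite_subset[OF _ finite_I]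
    by (auto simp: \<iota>_def char_algebra_simps carrier_char_algebra coordinates_add coordinates_scale)
  moreover have "\<pi> \<in> module_hom ?R (free_module ?R I) A"
  proof -
    have "\<pi> h \<in> char_lattice" for h
      unfolding \<pi>_def by (rule integral_conv_lattice[OF lattice_idempotent])
    moreover have "\<pi> (\<lambda>i. h i + k i) = (\<lambda>x. \<pi> h x + \<pi> k x)" for h k
      unfolding \<pi>_def conv_add_left[symmetric] by (rule arg_cong2[where f = "(\<star>)"]) auto
    moreover have "\<pi> (\<lambda>i. c * h i) = (\<lambda>x. to_fract c * \<pi> h x)" for c h
      unfolding \<pi>_def conv_scale_left[symmetric] by (rule arg_cong2[where f = "(\<star>)"]) auto
    ultimately show ?thesis
      by (simp add: module_hom_def free_module_def char_algebra_simps carrier_char_algebra)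
  qed
  moreover have "\<pi> (\<iota> f) = f" if "f \<in> carrier A" for f
  proof -
    have "(\<lambda>u. if u \<in> carrier G then \<iota> f (d u) else 0) = coordinates f"
      by (auto simp: \<iota>_def I_def inv_d coordinates_def)
    then show ?thesis
      using that coordinates_conv_idempotent by (simp add: \<pi>_def carrier_char_algebra)
  qed
  ultimately show ?thesis unfolding projective_module_def by blast
qed

section \<open>The symmetrizing form\<close>

definition pairing :: "('g \<Rightarrow> 'o fract) \<Rightarrow> ('g \<Rightarrow> 'o fract) \<Rightarrow> 'o" where
  "pairing f g = integer_part (N * (f \<star> g) \<one>)"

lemma to_fract_pairing:
  "f \<in> char_lattice \<Longrightarrow> g \<in> char_lattice \<Longrightarrow> to_fract (pairing f g) = N * (f \<star> g) \<one>"
  unfolding pairing_def by (intro to_fract_integer_part lattice_integral lattice_conv)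

lemma pairing_eqI:
  assumes "f \<in> char_lattice" "g \<in> char_lattice" "N * (f \<star> g) \<one> = to_fract c"
  shows "pairing f g = c"
  using to_fract_pairing[OF assms(1,2)] assms(3) by simp

lemma pairing_add_right:
  assumes "f \<in> char_lattice" "g \<in> char_lattice" "h \<in> char_lattice"
  shows "pairing f (\<lambda>x. g x + h x) = pairing f g + pairing f h"
  by (rule pairing_eqI)
    (use assms in \<open>simp_all add: lattice_add to_fract_pairing conv_add_right distrib_left\<close>)

lemma pairing_scale_right:
  assumes "f \<in> char_lattice" "g \<in> char_lattice"
  shows "pairing f (\<lambda>x. to_fract c * g x) = c * pairing f g"
  by (rule pairing_eqI)
    (use assms in \<open>simp_all add: lattice_scale to_fract_pairing conv_scale_right mult.left_commute\<close>)

lemma pairing_commute: "pairing f g = pairing g f"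
  by (simp add: pairing_def conv_one_commute)

lemma pairing_associative: "pairing (f \<star> g) h = pairing f (g \<star> h)"
  by (simp add: pairing_def conv_assoc)

lemma pairing_group_element:
  assumes "f \<in> char_lattice" "u \<in> carrier G"
  shows "to_fract (pairing f (group_element u)) = N * f (inv u)"
  using assms by (simp add: to_fract_pairing group_element_lattice conv_group_element_one)

lemma pairing_nondegenerate:
  assumes "f \<in> char_lattice" "g \<in> char_lattice" "\<And>h. h \<in> char_lattice \<Longrightarrow> pairing f h = pairing g h"
  shows "f = g"
proof
  fix x
  show "f x = g x"
  proof (cases "x \<in> carrier G")
    case True
    have "N * f (inv (inv x)) = N * g (inv (inv x))"
      using assms True by (metis group_element_lattice inv_closed pairing_group_element)
    then show ?thesis using True card_center_nonzero by simp
  qed (simp add: lattice_zero_outside[OF assms(1)] lattice_zero_outside[OF assms(2)])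
qed

text \<open>The value \<open>f(x)\<close> is forced by \<open>|Z| f(x) = (f, x\<^sup>-\<^sup>1 e(\<chi>)) = \<phi>(x\<^sup>-\<^sup>1 e(\<chi>))\<close>. The function so defined is
  equivariant because \<open>\<phi>\<close> is linear and \<open>x\<^sup>-\<^sup>1 z\<^sup>-\<^sup>1 e(\<chi>) = \<lambda>(z\<^sup>-\<^sup>1) x\<^sup>-\<^sup>1 e(\<chi>)\<close>, where \<open>\<lambda>\<close> is the character
  \<open>l\<close> of the center.\<close>

lemma pairing_representing_element:
  assumes \<phi>: "\<phi> \<in> module_hom (class_ring :: 'o ring) A (regular_module class_ring)"
  obtains f where "f \<in> char_lattice" "\<And>g. g \<in> char_lattice \<Longrightarrow> pairing f g = \<phi> g"
proof
  have \<phi>_add: "\<phi> (\<lambda>x. f x + g x) = \<phi> f + \<phi> g" if "f \<in> char_lattice" "g \<in> char_lattice" for f g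
    using module_hom_add[OF \<phi>, of f g] that
    by (simp add: char_algebra_simps carrier_char_algebra regular_module_def)
  have \<phi>_scale: "\<phi> (\<lambda>x. to_fract c * f x) = c * \<phi> f" if "f \<in> char_lattice" for c f
    using module_hom_smult[OF \<phi>, of c f] that
    by (simp add: char_algebra_simps carrier_char_algebra regular_module_def)
  define f where "f = (\<lambda>x. if x \<in> carrier G then to_fract (\<phi> (group_element (inv x))) / N else 0)"
  have "f (x \<otimes> z) = to_fract (l (inv z)) * f x" if x: "x \<in> carrier G" and z: "z \<in> Z" for x z
  proof -
    have "inv (x \<otimes> z) = inv x \<otimes> inv z"
      using x z center_closed center_commute[OF center_inv[OF z], of "inv x"]
      by (simp add: inv_mult_group)
    then have "\<phi> (group_element (inv (x \<otimes> z))) = l (inv z) * \<phi> (group_element (inv x))"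
      using x z by (simp add: group_element_center center_inv \<phi>_scale group_element_lattice)
    then show ?thesis using x z center_closed by (simp add: f_def)
  qed
  moreover have "N * f x \<in> range to_fract" for x
    using card_center_nonzero by (simp add: f_def range_to_fract_0)
  ultimately show f: "f \<in> char_lattice"
    by (simp add: char_lattice_def equivariant_def f_def)
  show "pairing f g = \<phi> g" if "g \<in> char_lattice" for g
    using that
  proof (induction rule: char_lattice_induct)
    case zero
    have "\<phi> (\<lambda>x. 0) = 0" using \<phi>_scale[OF lattice_zero, of 0] by simp
    moreover have "pairing f (\<lambda>x. 0) = 0" using pairing_scale_right[OF f lattice_zero, of 0] by simp
    ultimately show ?case by simp
  next
    case (generator u)
    then have "to_fract (pairing f (group_element u)) = to_fract (\<phi> (group_element u))"
      using f card_center_nonzero by (simp add: pairing_group_element f_def)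
    then show ?case by simp
  qed (use f in \<open>simp_all add: pairing_add_right pairing_scale_right \<phi>_add \<phi>_scale\<close>)
qed

text \<open>Symmetry and associativity of the form say that \<open>f \<mapsto> (f, _)\<close> is a homomorphism of bimodules;
  nondegeneracy and representability of functionals say that it is bijective.\<close>

theorem symmetric_char_algebra: "symmetric_algebra (class_ring :: 'o ring) A"
proof -
  let ?R = "class_ring :: 'o ring"
  define \<Phi> where "\<Phi> = (\<lambda>f. \<lambda>g\<in>char_lattice. pairing f g)"
  have dual: "\<Phi> f \<in> carrier (dual_module ?R A)" if "f \<in> char_lattice" for f
    using that lattice_add lattice_scale
    by (simp add: \<Phi>_def dual_module_def module_hom_def regular_module_def
      char_algebra_simps carrier_char_algebra pairing_add_right pairing_scale_right)
  have "\<Phi> \<in> module_hom ?R A (dual_module ?R A)"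
    unfolding module_hom_def
  proof (intro CollectI conjI allI impI)
    show "\<Phi> \<in> carrier A \<rightarrow> carrier (dual_module ?R A)"
      using dual by (simp add: carrier_char_algebra)
  next
    fix f g assume fg: "f \<in> carrier A \<and> g \<in> carrier A"
    show "\<Phi> (f \<oplus>\<^bsub>A\<^esub> g) = \<Phi> f \<oplus>\<^bsub>dual_module ?R A\<^esub> \<Phi> g"
    proof (rule ext)
      fix h
      show "\<Phi> (f \<oplus>\<^bsub>A\<^esub> g) h = (\<Phi> f \<oplus>\<^bsub>dual_module ?R A\<^esub> \<Phi> g) h"
        using fg pairing_add_right[of h f g]
        by (simp add: \<Phi>_def dual_module_def char_algebra_simps carrier_char_algebra
          pairing_commute[of _ h])
    qed
  next
    fix c f assume f: "c \<in> carrier ?R \<and> f \<in> carrier A"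
    show "\<Phi> (c \<odot>\<^bsub>A\<^esub> f) = c \<odot>\<^bsub>dual_module ?R A\<^esub> \<Phi> f"
    proof (rule ext)
      fix h
      show "\<Phi> (c \<odot>\<^bsub>A\<^esub> f) h = (c \<odot>\<^bsub>dual_module ?R A\<^esub> \<Phi> f) h"
        using f pairing_scale_right[of h f c]
        by (simp add: \<Phi>_def dual_module_def char_algebra_simps carrier_char_algebra
          pairing_commute[of _ h])
    qed
  qed
  moreover have "bij_betw \<Phi> (carrier A) (carrier (dual_module ?R A))"
  proof (rule bij_betw_imageI)
    show "inj_on \<Phi> (carrier A)"
    proof (rule inj_onI)
      fix f g assume fg: "f \<in> carrier A" "g \<in> carrier A" "\<Phi> f = \<Phi> g"
      have "pairing f h = pairing g h" if "h \<in> char_lattice" for h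
        using fun_cong[OF fg(3), of h] that by (simp add: \<Phi>_def)
      then show "f = g" using fg pairing_nondegenerate by (simp add: carrier_char_algebra)
    qed
    show "\<Phi> ` carrier A = carrier (dual_module ?R A)"
    proof (intro equalityI subsetI)
      fix \<phi> assume \<phi>: "\<phi> \<in> carrier (dual_module ?R A)"
      then have hom: "\<phi> \<in> module_hom ?R A (regular_module ?R)" and ext: "\<phi> \<in> extensional (carrier A)"
        by (simp_all add: dual_module_def)
      obtain f where f: "f \<in> char_lattice" "\<And>g. g \<in> char_lattice \<Longrightarrow> pairing f g = \<phi> g"
        using pairing_representing_element[OF hom] by blast
      have "\<Phi> f = \<phi>"
        using f ext by (auto simp: \<Phi>_def carrier_char_algebra extensional_def)
      then show "\<phi> \<in> \<Phi> ` carrier A" using f by (auto simp: carrier_char_algebra)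
    qed (use dual in \<open>auto simp: carrier_char_algebra\<close>)
  qed
  moreover have "\<Phi> (a \<otimes>\<^bsub>A\<^esub> f) = dual_left_action A a (\<Phi> f)"
    "\<Phi> (f \<otimes>\<^bsub>A\<^esub> a) = dual_right_action A (\<Phi> f) a" if af: "a \<in> carrier A" "f \<in> carrier A" for a f
  proof -
    have "pairing (a \<star> f) h = pairing f (h \<star> a)" for h
      by (metis pairing_associative pairing_commute)
    then show "\<Phi> (a \<otimes>\<^bsub>A\<^esub> f) = dual_left_action A a (\<Phi> f)"
      using af lattice_conv
      by (auto simp: \<Phi>_def dual_left_action_def char_algebra_simps carrier_char_algebra)
    show "\<Phi> (f \<otimes>\<^bsub>A\<^esub> a) = dual_right_action A (\<Phi> f) a"
      using af lattice_conv
      by (auto simp: \<Phi>_def dual_right_action_def char_algebra_simps carrier_char_algebra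
        pairing_associative)
  qed
  ultimately show ?thesis
    using associative_algebra_char_algebra finitely_generated_char_algebra projective_char_algebra
    unfolding symmetric_algebra_def by blast
qed

end

section \<open>Characters of central type\<close>

theorem proposition1p8:
  fixes p :: nat
    and G :: "('g, 'x) monoid_scheme"
    and \<chi> :: "'g \<Rightarrow> 'o::idom fract"
  assumes "prime p"
    and "complete_discrete_valuation_ring (class_ring :: 'o ring)"
    and "is_residue_field (class_ring :: 'o ring) (class_ring :: 'k::field ring)"
    and "CHAR('k) = p"
    and "CHAR('o fract) = 0"
    and "group G" and "finite (carrier G)"
    and "splitting_field TYPE('o fract) G"
    and "splitting_field TYPE('k) G"
    and "\<chi> \<in> Irr G"
    and "central_type G \<chi>"
  shows "symmetric_algebra (class_ring :: 'o ring) (char_algebra G \<chi>)"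
proof -
  obtain n \<rho> where irr: "irreducible_representation G n \<rho>"
    and \<chi>: "\<chi> = (\<lambda>g\<in>carrier G. mat_trace (\<rho> g))"
    using \<open>\<chi> \<in> Irr G\<close> unfolding Irr_def by blast
  interpret group G by fact
  interpret splitting_representation G n \<rho>
  proof
    show "\<exists>c. T = c \<cdot>\<^sub>m 1\<^sub>m n"
      if "T \<in> carrier_mat n n" "\<And>g. g \<in> carrier G \<Longrightarrow> T * \<rho> g = \<rho> g * T" for T
      using that irr \<open>splitting_field TYPE('o fract) G\<close> unfolding splitting_field_def by blast
  qed (use irr assms in \<open>simp_all add: irreducible_representation_def\<close>)
  have pid: "principal_domain (class_ring :: 'o ring)"
    using assms(2) by (simp add: complete_discrete_valuation_ring_def discrete_valuation_ring_def)
  have "order G > 0"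
    by (simp add: order_gt_0_iff_finite finite_carrier)
  then have integral: "central_character z \<in> range to_fract" if "z \<in> Z" for z
    using root_of_unity_integral[OF pid central_character_root_of_unity[OF that]] by simp
  define l where "l z = the_inv to_fract (central_character z)" for z
  have l: "to_fract (l z) = central_character z" if "z \<in> Z" for z
    unfolding l_def by (rule f_the_inv_into_f[OF _ integral[OF that]]) (simp add: inj_on_def)
  interpret central_idempotent G l \<chi>
  proof
    have "to_fract (l \<one>\<^bsub>G\<^esub>) = to_fract 1"
      by (simp add: l center_one central_character_one)
    then show "l \<one>\<^bsub>G\<^esub> = 1" by (simp only: to_fract_eq_iff)
  next
    fix z w assume "z \<in> Z" "w \<in> Z"
    then have "to_fract (l (z \<otimes>\<^bsub>G\<^esub> w)) = to_fract (l z * l w)"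
      by (simp add: l center_mult central_character_mult)
    then show "l (z \<otimes>\<^bsub>G\<^esub> w) = l z * l w" by (simp only: to_fract_eq_iff)
  next
    show "of_nat (card Z) \<noteq> (0 :: 'o fract)"
      using card_center_pos by (simp add: of_nat_eq_0_iff_char_0)
  next
    show "char_idempotent G \<chi> = (\<lambda>x. if x \<in> Z then to_fract (l (inv\<^bsub>G\<^esub> x)) / of_nat (card Z) else 0)"
      unfolding central_type_char_idempotent[OF \<chi> \<open>central_type G \<chi>\<close>]
      by (rule ext) (simp add: l center_inv)
  qed
  show ?thesis by (rule symmetric_char_algebra)
qed

end
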